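(* Let $G$ be a simple graph on $n\ge 2$ vertices. Then $$\Big\lceil\frac{|E(G)|}{2n-2}\Big\rceil \le \theta(G\times K_2)\le \Big\lceil\frac{n}{4}\Big\rceil.$$
   Context: The thickness $\theta(G)$ of a graph $G$ is the minimum number of planar subgraphs whose union is $G$. The Kronecker product $G\times H$ of graphs $G$ and $H$ is the graph with vertex set $V(G)\times V(H)$ in which $(g,h)$ and $(g',h')$ are adjacent if and only if $gg'\in E(G)$ and $hh'\in E(H)$. *)

theory Defs
  imports "HOL-Analysis.Analysis"
begin

definition simple_graph :: "'a set \<Rightarrow> 'a set set \<Rightarrow> bool" where
  "simple_graph V E \<longleftrightarrow> finite V \<and>
     (\<forall>e\<in>E. \<exists>u v. e = {u, v} \<and> u \<noteq> v \<and> u \<in> V \<and> v \<in> V)"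

definition planar :: "'a set \<Rightarrow> 'a set set \<Rightarrow> bool" where
  "planar V E \<longleftrightarrow> (\<exists>(pos :: 'a \<Rightarrow> complex) (\<gamma> :: 'a set \<Rightarrow> real \<Rightarrow> complex).
     inj_on pos V \<and>
     (\<forall>e\<in>E. arc (\<gamma> e) \<and> {pathstart (\<gamma> e), pathfinish (\<gamma> e)} = pos ` e \<and>
              path_image (\<gamma> e) \<inter> pos ` V = pos ` e) \<and>
     (\<forall>e\<in>E. \<forall>e'\<in>E. e \<noteq> e' \<longrightarrow> path_image (\<gamma> e) \<inter> path_image (\<gamma> e') \<subseteq> pos ` (e \<inter> e')))"

definition thickness :: "'a set \<Rightarrow> 'a set set \<Rightarrow> nat" where
  "thickness V E = (LEAST k. \<exists>(Vs :: nat \<Rightarrow> 'a set) (Es :: nat \<Rightarrow> 'a set set).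
     (\<forall>i<k. Vs i \<subseteq> V \<and> Es i \<subseteq> E \<and> (\<forall>e\<in>Es i. e \<subseteq> Vs i) \<and> planar (Vs i) (Es i)) \<and>
     (\<Union>i<k. Vs i) = V \<and> (\<Union>i<k. Es i) = E)"

definition kron_verts :: "'a set \<Rightarrow> 'b set \<Rightarrow> ('a \<times> 'b) set" where
  "kron_verts V1 V2 = V1 \<times> V2"

definition kron_edges :: "'a set set \<Rightarrow> 'b set set \<Rightarrow> ('a \<times> 'b) set set" where
  "kron_edges E1 E2 = {{(g, h), (g', h')} | g g' h h'. {g, g'} \<in> E1 \<and> {h, h'} \<in> E2}"

definition K2_verts :: "bool set" where "K2_verts = UNIV"
definition K2_edges :: "bool set set" where "K2_edges = {{False, True}}"

end

theory Submission
  imports Defs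
begin

text \<open>
  Lower bound. A bipartite plane graph with \<open>v \<ge> 3\<close> vertices has at most \<open>2v - 4\<close> edges, and
  \<open>G \<times> K\<^sub>2\<close> is bipartite with \<open>2n\<close> vertices and \<open>2|E(G)|\<close> edges. The edges of a drawing are arbitrary
  arcs, so Euler's formula is obtained topologically, adding one arc at a time. If the ends of the arc
  are already joined, the arc closes a Jordan curve and splits one face into exactly two, the two sides
  of the curve staying connected by Janiszewski's theorem; otherwise Janiszewski's theorem shows that
  no face is split. The same analysis shows that every edge lies on at most two faces. If there are at
  least two faces, the edges around a face separate the plane, so there are at least four of them,
  because at most three edges of a bipartite graph form a forest.

  Upper bound. Number the vertices by \<open>4i + j\<close> with \<open>j < 4\<close> and write \<open>u, v\<close> for the two copies of
  a vertex. Layer \<open>r\<close> consists of all edges between the two copies of block \<open>r\<close>, which form a cube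
  (\<open>K\<^sub>4\<^sub>,\<^sub>4\<close> minus a perfect matching), and of edges joining every vertex outside block \<open>r\<close> to a pair of
  opposite corners of one face of this cube. The cube is drawn as two concentric squares. The inner
  and the outer face stay empty, and each of the four faces in between receives vertices attached to
  the same diagonal, so no two edges cross.
\<close>

section \<open>Attaching an arc to a compact set in the plane\<close>

text \<open>A ball inside the arc would be mapped injectively into the reals by the inverse
  homeomorphism. Deleting one point keeps a ball of dimension at least 2 connected, whereas deleting
  a value between two others disconnects a set of reals.\<close>

lemma interior_path_image_arc:
  fixes g :: "real \<Rightarrow> 'a::euclidean_space"
  assumes "arc g" "2 \<le> DIM('a)"
  shows "interior (path_image g) = {}"
proof (rule ccontr)
  assume "interior (path_image g) \<noteq> {}"
  then obtain x e where e: "e > 0" and xe: "ball x e \<subseteq> path_image g"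
    by (metis all_not_in_conv mem_interior)
  obtain h where h: "homeomorphism {0..1} (path_image g) g h"
    using homeomorphism_arc[OF \<open>arc g\<close>] by blast
  define S where "S = h ` ball x e"
  have inj: "inj_on h (ball x e)"
    using h xe by (intro inj_on_inverseI[of _ g]) (auto simp: homeomorphism_def)
  have "infinite (ball x e)"
    using e by (metis finite_imp_not_open centre_in_ball empty_iff open_ball)
  then have inf: "infinite S"
    unfolding S_def using inj finite_imageD by blast
  obtain F where F: "F \<subseteq> S" "finite F" "card F = 3"
    using inf by (meson infinite_arbitrarily_large)
  \<comment> \<open>Three parameters are taken so that the middle one, \<open>b\<close>, separates
    the other two.\<close>
  obtain a b c where abc: "a \<in> S" "b \<in> S" "c \<in> S" "a < b" "b < c"
  proof -
    have l: "length (sorted_list_of_set F) = 3" "sorted_wrt (<) (sorted_list_of_set F)"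
      "set (sorted_list_of_set F) = F"
      using F by auto
    then obtain p q r where "sorted_list_of_set F = [p,q,r]"
      unfolding numeral_3_eq_3 length_Suc_conv by blast
    then show thesis using that l F by auto
  qed
  obtain y where y: "y \<in> ball x e" "h y = b"
    using abc by (auto simp: S_def)
  have "connected (ball x e - {y})"
    using assms(2) by (intro connected_open_delete) auto
  moreover have "continuous_on (ball x e - {y}) h"
    using h xe by (meson Diff_subset continuous_on_subset homeomorphism_cont2)
  ultimately have "connected (h ` (ball x e - {y}))"
    using connected_continuous_image by blast
  moreover have "h ` (ball x e - {y}) = S - {b}"
    using inj y unfolding S_def by (auto simp: inj_on_def)
  ultimately have "b \<in> S - {b}"
    using abc connectedD_interval[of "S - {b}" a c b] by auto
  then show False by simp
qed

text \<open>Components other than \<open>F\<close> are disjoint from \<open>A\<close>, hence they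
  survive and stay maximal. Only \<open>F\<close> has to be examined when something is removed from
  it.\<close>

lemma components_Diff_subset_component:
  assumes "F \<in> components S" "A \<subseteq> F"
  shows "components (S - A) = (components S - {F}) \<union> {C \<in> components (S - A). C \<subseteq> F}"
proof (intro equalityI subsetI)
  fix C assume C: "C \<in> components (S - A)"
  then have "C \<noteq> {}" "C \<subseteq> S - A" "connected C"
    by (auto simp: in_components_nonempty in_components_subset in_components_connected)
  then obtain G where G: "G \<in> components S" "C \<subseteq> G"
    using exists_component_superset[of C S] by blast
  show "C \<in> (components S - {F}) \<union> {C \<in> components (S - A). C \<subseteq> F}"
  proof (cases "G = F")
    case False
    then have "G \<subseteq> S - A"
      using G assms components_nonoverlap[of G S F] in_components_subset[of G S] by blast
    then have "G = C"
      using C G \<open>C \<noteq> {}\<close> components_maximal[of C "S - A" G] in_components_connected[of G S] by blast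
    then show ?thesis using G False by auto
  qed (use C G in auto)
next
  fix C assume C: "C \<in> (components S - {F}) \<union> {C \<in> components (S - A). C \<subseteq> F}"
  show "C \<in> components (S - A)"
  proof (cases "C \<in> components S - {F}")
    case True
    then have "C \<subseteq> S - A"
      using assms components_nonoverlap[of C S F] in_components_subset[of C S] by blast
    with True show ?thesis
      using in_components_maximal[of C S] unfolding in_components_maximal[of C "S - A"] by blast
  qed (use C in auto)
qed

locale arc_attached =
  fixes X :: "complex set" and g :: "real \<Rightarrow> complex"
  assumes compact_X: "compact X" and arc_g: "arc g"
    and g_Int_X: "path_image g \<inter> X = {pathstart g, pathfinish g}"
begin

text \<open>The parameter 1/2 merely selects a point of the open arc, which is connected and misses
  \<open>X\<close>, so the whole open arc lies in this face.\<close>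

definition host where "host = connected_component_set (- X) (g (1/2))"

definition sides where "sides = {C \<in> components (- (X \<union> path_image g)). C \<subseteq> host}"

lemma open_arc: "path_image g - X = g ` {0<..<1}"
proof -
  have inj: "inj_on g {0..1}"
    using arc_g by (simp add: arc_def)
  have "path_image g - X = path_image g - {g 0, g 1}"
    using g_Int_X by (auto simp: pathstart_def pathfinish_def)
  also have "\<dots> = g ` ({0..1} - {0,1})"
    unfolding path_image_def using inj by (subst inj_on_image_set_diff[OF inj]) auto
  also have "{0..1} - {0,1} = {0<..<1::real}" by auto
  finally show ?thesis .
qed

lemma mid_notin: "g (1/2) \<notin> X" "g (1/2) \<in> path_image g"
  using open_arc by auto

lemma host_component: "host \<in> components (- X)"
  unfolding host_def using mid_notin by (auto simp: components_def)

lemma open_host: "open host"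
  unfolding host_def using compact_X by (simp add: compact_imp_closed open_Compl open_connected_component)

lemma open_arc_subset_host: "path_image g - X \<subseteq> host"
proof -
  have "continuous_on {0..1} g"
    using arc_g by (simp add: arc_def path_def)
  then have "connected (g ` {0<..<1})"
    by (intro connected_continuous_image) (auto elim: continuous_on_subset)
  then show ?thesis
    unfolding host_def using open_arc by (intro connected_component_maximal) auto
qed

lemma components_attached:
  "components (- (X \<union> path_image g)) = (components (- X) - {host}) \<union> sides"
  "(components (- X) - {host}) \<inter> sides = {}"
proof -
  have eq: "- X - (path_image g - X) = - (X \<union> path_image g)" by blast
  show "components (- (X \<union> path_image g)) = (components (- X) - {host}) \<union> sides"
    using components_Diff_subset_component[OF host_component open_arc_subset_host] unfolding eq sides_def .
  show "(components (- X) - {host}) \<inter> sides = {}"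
  proof (rule ccontr)
    assume "(components (- X) - {host}) \<inter> sides \<noteq> {}"
    then obtain C where "C \<in> components (- X)" "C \<noteq> host" "C \<subseteq> host"
      by (auto simp: sides_def)
    then show False
      using host_component components_nonoverlap[of C "- X" host] in_components_nonempty[of C "- X"] by blast
  qed
qed

text \<open>Any other component is a face of \<open>X\<close> disjoint from the open set
  \<open>host\<close>, so even its closure avoids \<open>host\<close> and with it the open
  arc.\<close>

lemma touching_component_in_sides:
  assumes "C \<in> components (- (X \<union> path_image g))" "closure C \<inter> (path_image g - X) \<noteq> {}"
  shows "C \<in> sides"
proof (rule ccontr)
  assume "C \<notin> sides"
  then have "C \<in> components (- X)" "C \<noteq> host"
    using assms components_attached by auto
  then have "C \<inter> host = {}"
    using host_component components_nonoverlap by blast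
  then have "closure C \<inter> host = {}"
    using open_host by (metis Int_commute open_Int_closure_eq_empty)
  then show False
    using assms(2) open_arc_subset_host by auto
qed

lemma sidesE:
  assumes "C \<in> sides"
  obtains a where "a \<in> host" "a \<notin> X \<union> path_image g" "C = connected_component_set (- (X \<union> path_image g)) a"
proof -
  obtain a where a: "a \<in> - (X \<union> path_image g)" "C = connected_component_set (- (X \<union> path_image g)) a"
    using assms by (auto simp: sides_def components_def)
  then have "a \<in> C"
    by simp
  moreover have "C \<subseteq> host" using assms by (simp add: sides_def)
  ultimately show thesis using a that by blast
qed

lemma sidesI:
  assumes "a \<in> host" "a \<notin> X \<union> path_image g"
  shows "connected_component_set (- (X \<union> path_image g)) a \<in> sides"
proof -
  have "connected_component_set (- (X \<union> path_image g)) a \<subseteq> connected_component_set (- X) a"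
    by (rule connected_component_mono) auto
  also have "\<dots> = host"
    using assms(1) unfolding host_def by (metis connected_component_eq)
  finally show ?thesis
    using assms(2) by (auto simp: sides_def components_def)
qed

lemma host_connected: "a \<in> host \<Longrightarrow> b \<in> host \<Longrightarrow> connected_component (- X) a b"
  using host_component by (meson connected_component_def in_components_connected in_components_subset)

text \<open>The two arcs form a Jordan curve \<open>J\<close>, and \<open>J\<close> meets
  \<open>X\<close> in the connected set \<open>path_image b\<close>. By Janiszewski's theorem,
  points of \<open>host\<close> on the same side of \<open>J\<close> can therefore be joined off
  \<open>X\<close> and \<open>J\<close> together. Both sides of \<open>J\<close> meet
  \<open>host\<close>, which gives exactly two pieces.\<close>

lemma card_sides_cycle:
  assumes b: "arc b" "path_image b \<subseteq> X" "{pathstart b, pathfinish b} = {pathstart g, pathfinish g}"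
  shows "card sides = 2" "finite sides"
proof -
  \<comment> \<open>Here \<open>c\<close> is \<open>b\<close> or its reverse, oriented so that
    \<open>g +++ c\<close> is a closed path.\<close>
  obtain c where c: "arc c" "path_image c = path_image b" "pathstart c = pathfinish g" "pathfinish c = pathstart g"
  proof (cases "pathstart b = pathfinish g")
    case True
    then show thesis using b that[of b] by (metis doubleton_eq_iff)
  next
    case False
    then show thesis using b that[of "reversepath b"]
      by (metis doubleton_eq_iff arc_reversepath path_image_reversepath pathfinish_reversepath pathstart_reversepath)
  qed
  define J where "J = path_image g \<union> path_image c"
  have Jc: "J = path_image (g +++ c)"
    using c by (simp add: J_def path_image_join)
  have int: "path_image g \<inter> path_image c = {pathstart g, pathstart c}"
    using g_Int_X b(2) c pathfinish_in_path_image[of c] pathstart_in_path_image[of c] by auto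
  have simple: "simple_path (g +++ c)"
    using c arc_g int by (intro simple_path_join_loop) auto
  have "pathfinish (g +++ c) = pathstart (g +++ c)"
    using c by simp
  note Jordan = Jordan_inside_outside[OF simple this, folded Jc]
  have JX: "J \<inter> X = path_image c"
  proof -
    have "{pathstart g, pathfinish g} \<subseteq> path_image c"
      using c pathfinish_in_path_image[of c] pathstart_in_path_image[of c] by auto
    then show ?thesis
      using g_Int_X b(2) c(2) unfolding J_def by blast
  qed
  have XJ: "X \<union> J = X \<union> path_image g"
    using b c by (auto simp: J_def)
  have cJ: "compact J"
    unfolding Jc using simple by (simp add: compact_path_image simple_path_imp_path)
  have conn: "connected_component (- (X \<union> path_image g)) u v"
    if "u \<in> host" "v \<in> host" "connected_component (- J) u v" for u v
  proof -
    have "connected (J \<inter> X)"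
      unfolding JX using c(1) by (simp add: arc_imp_path connected_path_image)
    then have "connected_component (- (J \<union> X)) u v"
      using Janiszewski[OF cJ compact_imp_closed[OF compact_X]] that host_connected by blast
    then show ?thesis using XJ by (metis Un_commute)
  qed
  have mJ: "g (1/2) \<in> J" using mid_notin J_def by auto
  have mF: "g (1/2) \<in> host"
    unfolding host_def using mid_notin by simp
  \<comment> \<open>The midpoint of \<open>g\<close> lies on the common frontier of inside and
    outside, and \<open>host\<close> is an open neighbourhood of it.\<close>
  have near: "\<exists>u\<in>host. u \<in> R" if "frontier R = J" for R
  proof -
    have "g (1/2) \<in> closure R" using that mJ by (auto simp: frontier_def)
    then show ?thesis
      using open_host mF open_Int_closure_eq_empty[of host R] by blast
  qed
  obtain u where u: "u \<in> host" "u \<in> inside J" using near[of "inside J"] Jordan by metis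
  obtain v where v: "v \<in> host" "v \<in> outside J" using near[of "outside J"] Jordan by metis
  let ?C = "connected_component_set (- (X \<union> path_image g))"
  have FX: "w \<notin> X" if "w \<in> host" for w
    using that host_component in_components_subset by blast
  have conn_in: "connected (inside J)" "connected (outside J)"
    and Jdisj: "open (inside J)" "open (outside J)" "inside J \<inter> outside J = {}"
    using Jordan by auto
  have Jun: "inside J \<union> outside J = - J" using Jordan by metis
  have notin: "w \<notin> X \<union> path_image g" if "w \<in> host" "w \<in> inside J \<union> outside J" for w
    using that FX Jun by (auto simp: J_def)
  have "sides \<subseteq> {?C u, ?C v}"
  proof
    fix C assume "C \<in> sides"
    then obtain a where a: "a \<in> host" "a \<notin> X \<union> path_image g" "C = ?C a"
      by (rule sidesE)
    then have "a \<in> inside J \<union> outside J" using Jun XJ by auto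
    then have "connected_component (- J) a u \<or> connected_component (- J) a v"
    proof
      assume "a \<in> inside J"
      then have "connected_component (- J) a u"
        using u Jun conn_in unfolding connected_component_def by blast
      then show ?thesis ..
    next
      assume "a \<in> outside J"
      then have "connected_component (- J) a v"
        using v Jun conn_in unfolding connected_component_def by blast
      then show ?thesis ..
    qed
    then have "connected_component (- (X \<union> path_image g)) a u \<or> connected_component (- (X \<union> path_image g)) a v"
      using conn a u v by blast
    then show "C \<in> {?C u, ?C v}"
      using a(3) connected_component_eq[of u _ a] connected_component_eq[of v _ a] by (metis insertCI mem_Collect_eq)
  qed
  moreover have "?C u \<in> sides" "?C v \<in> sides"
    using sidesI[OF u(1) notin] sidesI[OF v(1) notin] u v by blast+
  ultimately have S: "sides = {?C u, ?C v}" by blast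
  have "?C u \<noteq> ?C v"
  proof
    assume "?C u = ?C v"
    moreover have "v \<in> ?C v" using v notin[of v] by (meson ComplI UnI2 connected_component_refl mem_Collect_eq)
    ultimately have "v \<in> ?C u" by blast
    then have "connected_component (- J) u v"
      using connected_component_of_subset[of "- (X \<union> path_image g)" u v "- J"] XJ by auto
    then obtain T where T: "connected T" "T \<subseteq> - J" "u \<in> T" "v \<in> T"
      by (auto simp: connected_component_def)
    have "connected T" "T \<subseteq> inside J \<union> outside J" "inside J \<inter> T \<noteq> {}" "outside J \<inter> T \<noteq> {}"
      using T u v Jun by auto
    then show False
      using Jdisj connectedD[of T "inside J" "outside J"] by auto
  qed
  then show "card sides = 2" "finite sides" using S by auto
qed

text \<open>The complement of an arc is connected. Adding \<open>X1\<close> and then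
  \<open>X2\<close> to the arc keeps points of \<open>host\<close> joined by Janiszewski's theorem,
  because each addition meets the earlier set in a single end point.\<close>

lemma card_sides_bridge:
  assumes X: "X = X1 \<union> X2" "X1 \<inter> X2 = {}" "closed X1" "closed X2"
    and st: "pathstart g \<in> X1" "pathfinish g \<in> X2"
  shows "card sides = 1" "finite sides"
proof -
  have cg: "compact (path_image g)"
    using arc_g by (simp add: arc_imp_path compact_path_image)
  have X12: "compact X1" "compact X2"
    using X compact_X by (metis Int_absorb1 Int_commute compact_Int_closed Un_upper1 Un_upper2)+
  have g1: "path_image g \<inter> X1 = {pathstart g}" "(path_image g \<union> X1) \<inter> X2 = {pathfinish g}"
    using g_Int_X X st by auto
  have conn: "connected_component (- (X \<union> path_image g)) u v"
    if uv: "u \<in> host" "v \<in> host" "u \<notin> path_image g" "v \<notin> path_image g" for u v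
  proof -
    have cX: "connected_component (- X) u v" using uv host_connected by blast
    then have c1: "connected_component (- X1) u v" "connected_component (- X2) u v"
      by (rule connected_component_of_subset, use X in auto)+
    have "connected_component (- path_image g) u v"
      using connected_arc_complement[OF arc_g] uv by (auto simp: connected_component_def)
    then have "connected_component (- (path_image g \<union> X1)) u v"
      using Janiszewski[OF cg \<open>closed X1\<close>] c1 g1 by simp
    then have "connected_component (- (path_image g \<union> X1 \<union> X2)) u v"
      using Janiszewski[OF compact_Un[OF cg X12(1)] \<open>closed X2\<close>] c1 g1 by simp
    then show ?thesis using X by (simp add: Un_ac)
  qed
  have "\<not> host \<subseteq> path_image g"
    using interior_path_image_arc[OF arc_g] open_host mid_notin
    by (metis host_component DIM_complex dual_order.refl in_components_nonempty interior_maximal subset_empty)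
  then obtain u where u: "u \<in> host" "u \<notin> path_image g" by auto
  have FX: "w \<notin> X" if "w \<in> host" for w
    using that host_component in_components_subset by blast
  have "sides = {connected_component_set (- (X \<union> path_image g)) u}"
  proof (intro equalityI subsetI)
    fix C assume "C \<in> sides"
    then obtain a where a: "a \<in> host" "a \<notin> X \<union> path_image g" "C = connected_component_set (- (X \<union> path_image g)) a"
      by (rule sidesE)
    then show "C \<in> {connected_component_set (- (X \<union> path_image g)) u}"
      using conn[of a u] u connected_component_eq[of u _ a] by (metis UnI2 mem_Collect_eq singletonI)
  qed (use u FX sidesI in auto)
  then show "card sides = 1" "finite sides" by auto
qed

end

section \<open>Euler's formula for plane drawings\<close>

locale plane_drawing =
  fixes V :: "'a set" and E :: "'a set set"
    and pos :: "'a \<Rightarrow> complex" and \<gamma> :: "'a set \<Rightarrow> real \<Rightarrow> complex"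
  assumes graph: "simple_graph V E" and V_nonempty: "V \<noteq> {}"
    and inj: "inj_on pos V"
    and arcs: "\<And>e. e \<in> E \<Longrightarrow> arc (\<gamma> e)"
    and ends: "\<And>e. e \<in> E \<Longrightarrow> {pathstart (\<gamma> e), pathfinish (\<gamma> e)} = pos ` e"
    and Int_V: "\<And>e. e \<in> E \<Longrightarrow> path_image (\<gamma> e) \<inter> pos ` V = pos ` e"
    and Int_edges: "\<And>e e'. e \<in> E \<Longrightarrow> e' \<in> E \<Longrightarrow> e \<noteq> e' \<Longrightarrow>
      path_image (\<gamma> e) \<inter> path_image (\<gamma> e') \<subseteq> pos ` (e \<inter> e')"
begin

lemma finite_V: "finite V"
  using graph by (simp add: simple_graph_def)

lemma edge_subset: "e \<in> E \<Longrightarrow> e \<subseteq> V"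
  using graph by (fastforce simp: simple_graph_def)

lemma finite_E: "finite E"
  using edge_subset finite_V by (meson Sup_le_iff finite_UnionD finite_subset)

lemma edgeE:
  assumes "e \<in> E"
  obtains u v where "e = {u, v}" "u \<noteq> v" "u \<in> V" "v \<in> V" "pathstart (\<gamma> e) = pos u" "pathfinish (\<gamma> e) = pos v"
proof -
  obtain a b where ab: "e = {a, b}" "a \<noteq> b" "a \<in> V" "b \<in> V"
    using assms graph by (auto simp: simple_graph_def)
  then have "{pathstart (\<gamma> e), pathfinish (\<gamma> e)} = {pos a, pos b}"
    using ends[OF assms] by simp
  then show thesis
    using ab that[of a b] that[of b a] by (metis doubleton_eq_iff)
qed

text \<open>All vertices are present whichever edges are drawn, so every further edge is an arc
  attached at both ends.\<close>

definition drawn :: "'a set set \<Rightarrow> complex set" where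
  "drawn E' = pos ` V \<union> (\<Union>e\<in>E'. path_image (\<gamma> e))"

definition faces :: "'a set set \<Rightarrow> complex set set" where
  "faces E' = components (- drawn E')"

lemma drawn_insert: "drawn (insert e E') = drawn E' \<union> path_image (\<gamma> e)"
  by (auto simp: drawn_def)

lemma drawn_mono: "E1 \<subseteq> E2 \<Longrightarrow> drawn E1 \<subseteq> drawn E2"
  by (auto simp: drawn_def)

lemma compact_edge: "e \<in> E \<Longrightarrow> compact (path_image (\<gamma> e))"
  using arcs by (simp add: arc_imp_path compact_path_image)

lemma compact_drawn:
  assumes "E' \<subseteq> E" shows "compact (drawn E')"
proof -
  have "finite E'" using assms finite_E finite_subset by blast
  then show ?thesis
    unfolding drawn_def using finite_V assms compact_edge
    by (intro compact_Un compact_UN finite_imp_compact[of "pos ` V"]) auto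
qed

lemma edge_Int_drawn:
  assumes "E' \<subseteq> E" "e \<in> E" "e \<notin> E'"
  shows "path_image (\<gamma> e) \<inter> drawn E' = pos ` e"
proof -
  have "path_image (\<gamma> e) \<inter> path_image (\<gamma> e') \<subseteq> pos ` e" if "e' \<in> E'" for e'
    using Int_edges[of e e'] assms that by blast
  then show ?thesis
    using Int_V[OF assms(2)] unfolding drawn_def by blast
qed

lemma attached:
  assumes "E' \<subseteq> E" "e \<in> E" "e \<notin> E'"
  shows "arc_attached (drawn E') (\<gamma> e)"
  using compact_drawn arcs edge_Int_drawn ends assms by unfold_locales auto

lemma edge_minus_drawn:
  assumes "E' \<subseteq> E" "e \<in> E" "e \<notin> E'"
  shows "path_image (\<gamma> e) - drawn E' = path_image (\<gamma> e) - pos ` V"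
  using edge_Int_drawn[OF assms] Int_V[OF assms(2)] by blast

text \<open>The first clause serves the bridge case, where different labels split the drawing into
  disjoint closed parts. The second serves the cycle case, where equal labels provide a path between
  the ends.\<close>

definition labels :: "'a set set \<Rightarrow> ('a \<Rightarrow> 'a) \<Rightarrow> bool" where
  "labels E' lab \<longleftrightarrow> (\<forall>u v. {u, v} \<in> E' \<longrightarrow> lab u = lab v) \<and>
     (\<forall>u\<in>V. \<forall>v\<in>V. lab u = lab v \<longrightarrow> path_component (drawn E') (pos u) (pos v))"

lemma sides_cycle:
  assumes E': "E' \<subseteq> E" "{u, v} \<in> E" "{u, v} \<notin> E'" and lab: "labels E' lab" "lab u = lab v"
  shows "card (arc_attached.sides (drawn E') (\<gamma> {u, v})) = 2"
    "finite (arc_attached.sides (drawn E') (\<gamma> {u, v}))"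
proof -
  interpret arc_attached "drawn E'" "\<gamma> {u, v}"
    using attached E' by blast
  have uv: "u \<in> V" "v \<in> V"
    using edge_subset E' by auto
  then obtain p where p: "path p" "path_image p \<subseteq> drawn E'" "pathstart p = pos u" "pathfinish p = pos v"
    using lab unfolding labels_def path_component_def by blast
  have "pos u \<noteq> pos v"
    using arcs[OF E'(2)] ends[OF E'(2)] arc_distinct_ends by fastforce
  \<comment> \<open>The path in the drawing is thinned to an arc, which closes the new edge to a
    Jordan curve.\<close>
  then obtain b where "arc b" "path_image b \<subseteq> path_image p" "pathstart b = pos u" "pathfinish b = pos v"
    using path_contains_arc p by metis
  then have "arc b" "path_image b \<subseteq> drawn E'"
    "{pathstart b, pathfinish b} = {pathstart (\<gamma> {u, v}), pathfinish (\<gamma> {u, v})}"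
    using p ends[OF E'(2)] by auto
  then show "card sides = 2" "finite sides"
    using card_sides_cycle by blast+
qed

text \<open>The vertices and edges labelled like one end of the new edge, and all the others, form
  two disjoint closed parts that the edge links. Only constancy of \<open>lab\<close> along edges is
  assumed, so an ad hoc labelling may be supplied.\<close>

lemma sides_bridge:
  fixes lab :: "'a \<Rightarrow> 'a"
  assumes E': "E' \<subseteq> E" "{u, v} \<in> E" "{u, v} \<notin> E'"
    and lab: "\<And>u v. {u, v} \<in> E' \<Longrightarrow> lab u = lab v" "lab u \<noteq> lab v"
  shows "card (arc_attached.sides (drawn E') (\<gamma> {u, v})) = 1"
    "finite (arc_attached.sides (drawn E') (\<gamma> {u, v}))"
proof -
  interpret arc_attached "drawn E'" "\<gamma> {u, v}"
    using attached E' by blast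
  obtain a b where ab: "{u, v} = {a, b}" "a \<in> V" "b \<in> V"
    "pathstart (\<gamma> {u, v}) = pos a" "pathfinish (\<gamma> {u, v}) = pos b"
    using edgeE[OF E'(2)] by metis
  then have lab_ab: "lab a \<noteq> lab b"
    using lab(2) by (metis doubleton_eq_iff)
  define part where "part P = pos ` {x \<in> V. P (lab x)} \<union> (\<Union>e\<in>{e\<in>E'. \<forall>x\<in>e. P (lab x)}. path_image (\<gamma> e))"
    for P :: "'a \<Rightarrow> bool"
  have closed: "closed (part P)" for P
  proof -
    have "finite E'" using E' finite_E finite_subset by blast
    then show ?thesis
      unfolding part_def using finite_V E' compact_edge
      by (intro compact_imp_closed compact_Un compact_UN finite_imp_compact[of "pos ` _"]) auto
  qed
  have dichotomy: "(\<forall>x\<in>e. P (lab x)) \<or> (\<forall>x\<in>e. \<not> P (lab x))" if e: "e \<in> E'" for e P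
  proof -
    obtain x y where "e = {x, y}"
      using edgeE[of e] e E' by blast
    then show ?thesis using lab(1)[of x y] e by auto
  qed
  have un: "drawn E' = part P \<union> part (\<lambda>x. \<not> P x)" for P
    unfolding drawn_def part_def using dichotomy[of _ P] by blast
  have int: "part P \<inter> part (\<lambda>x. \<not> P x) = {}" for P
  proof -
    have z: "\<exists>x\<in>V. P (lab x) \<and> z = pos x" if z: "z \<in> part P" and zV: "z \<in> pos ` V" for z P
    proof (cases "z \<in> pos ` {x \<in> V. P (lab x)}")
      case False
      then obtain e where e: "e \<in> E'" "\<forall>x\<in>e. P (lab x)" "z \<in> path_image (\<gamma> e)"
        using z by (auto simp: part_def)
      then have "z \<in> pos ` e"
        using Int_V[of e] zV E' by blast
      then show ?thesis using e edge_subset[of e] E' by blast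
    qed auto
    have False if zP: "z \<in> part P" "z \<in> part (\<lambda>x. \<not> P x)" for z
    proof (cases "z \<in> pos ` V")
      case True
      then obtain x y where "x \<in> V" "y \<in> V" "pos x = pos y" "P (lab x)" "\<not> P (lab y)"
        using z[OF zP(1)] z[OF zP(2)] by auto
      then show False using inj by (metis inj_on_def)
    next
      case False
      then obtain e e' where e: "e \<in> E'" "e' \<in> E'" "z \<in> path_image (\<gamma> e)" "z \<in> path_image (\<gamma> e')"
        "\<forall>x\<in>e. P (lab x)" "\<forall>x\<in>e'. \<not> P (lab x)"
        using zP by (auto simp: part_def)
      have "e \<noteq> {}" using edgeE[of e] e(1) E' by blast
      then have "e \<noteq> e'" using e by auto
      then have "z \<in> pos ` (e \<inter> e')"
        using Int_edges[of e e'] e E' by blast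
      then show False using e by blast
    qed
    then show ?thesis by blast
  qed
  let ?P = "\<lambda>l. l = lab a"
  have "pos a \<in> part ?P" "pos b \<in> part (\<lambda>x. \<not> ?P x)"
    using ab lab_ab by (auto simp: part_def)
  then show "card sides = 1" "finite sides"
    using card_sides_bridge[OF un[of ?P] int closed closed] ab by auto
qed

text \<open>The face \<open>host\<close> is exchanged for \<open>sides\<close> and all other faces
  remain; the summand 1 accounts for the lost \<open>host\<close>.\<close>

lemma card_faces_insert:
  assumes E': "E' \<subseteq> E" "e \<in> E" "e \<notin> E'" "finite (faces E')"
    and sides: "finite (arc_attached.sides (drawn E') (\<gamma> e))"
  shows "finite (faces (insert e E'))"
    "card (faces (insert e E')) + 1 = card (faces E') + card (arc_attached.sides (drawn E') (\<gamma> e))"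
proof -
  interpret arc_attached "drawn E'" "\<gamma> e"
    using attached E' by blast
  have eq: "faces (insert e E') = (faces E' - {host}) \<union> sides" "(faces E' - {host}) \<inter> sides = {}"
    using components_attached by (simp_all add: faces_def drawn_insert)
  then show "finite (faces (insert e E'))" using E' sides by simp
  have host: "host \<in> faces E'" using host_component by (simp add: faces_def)
  have "card (faces (insert e E')) = card (faces E' - {host}) + card sides"
    unfolding eq(1) using E' sides eq(2) by (intro card_Un_disjoint) auto
  then show "card (faces (insert e E')) + 1 = card (faces E') + card sides"
    using card_Suc_Diff1[OF E'(4) host] by linarith
qed

lemma connected_Compl_vertices: "connected (- drawn {})" "- drawn {} \<noteq> {}"
proof -
  have fin: "finite (drawn {})" using finite_V by (simp add: drawn_def)
  then show "connected (- drawn {})"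
    by (intro path_connected_imp_connected path_connected_complement_countable)
      (auto simp: countable_finite)
  show "- drawn {} \<noteq> {}"
    using fin infinite_UNIV_char_0 by (metis Compl_empty_eq double_compl)
qed

text \<open>
  The labelling is the union-find structure of the components: it lets the topological Euler
  formula be proved edge by edge without any theory of paths in graphs.
\<close>

lemma Euler_labels:
  assumes "E' \<subseteq> E"
  shows "\<exists>lab. labels E' lab \<and> finite (faces E') \<and>
    card (faces E') + card V = card E' + 1 + card (lab ` V)"
proof -
  have "finite E'" using assms finite_E finite_subset by blast
  then show ?thesis using assms
  proof (induction E' rule: finite_induct)
    case empty
    have "labels {} id"
      by (auto simp: labels_def path_component_refl_eq drawn_def)
    moreover have "faces {} = {- drawn {}}"
      unfolding faces_def components_eq_sing_iff using connected_Compl_vertices by blast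
    ultimately show ?case by (intro exI[of _ id] conjI) (simp_all only: card_1_singleton_iff image_id, simp_all)
  next
    case (insert e E')
    then obtain lab where lab: "labels E' lab" "finite (faces E')"
      "card (faces E') + card V = card E' + 1 + card (lab ` V)" by auto
    have e: "E' \<subseteq> E" "e \<in> E" "e \<notin> E'" using insert by auto
    obtain u v where uv: "e = {u, v}" "u \<in> V" "v \<in> V" "pathstart (\<gamma> e) = pos u" "pathfinish (\<gamma> e) = pos v"
      using edgeE e by metis
    have mono: "path_component (drawn (insert e E')) x y" if "path_component (drawn E') x y" for x y
      using that drawn_mono[of E' "insert e E'"] path_component_of_subset by blast
    show ?case
    proof (cases "lab u = lab v")
      case True
      \<comment> \<open>Cycle case: one more edge, one more face, the same labels.\<close>
      have "labels (insert e E') lab"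
        using lab(1) True uv mono unfolding labels_def by (auto simp: doubleton_eq_iff)
      moreover have "card (arc_attached.sides (drawn E') (\<gamma> e)) = 2" "finite (arc_attached.sides (drawn E') (\<gamma> e))"
        using sides_cycle[of E' u v lab] e lab True uv by auto
      ultimately show ?thesis
        using card_faces_insert[OF e lab(2)] lab(3) insert(1,2) by (intro exI[of _ lab]) auto
    next
      case False
      \<comment> \<open>Bridge case: merging the class of \<open>u\<close> into that of
        \<open>v\<close> loses one label, while the number of faces is unchanged.\<close>
      define lab' where "lab' x = (if lab x = lab u then lab v else lab x)" for x
      have "path_component (drawn (insert e E')) (pos u) (pos v)"
        unfolding path_component_def using arcs[OF e(2)] uv
        by (intro exI[of _ "\<gamma> e"]) (auto simp: drawn_insert arc_imp_path)
      then have uv': "path_component (drawn (insert e E')) (pos u) (pos v)"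
        "path_component (drawn (insert e E')) (pos v) (pos u)"
        by (auto intro: path_component_sym)
      have pc: "path_component (drawn (insert e E')) (pos x) (pos y)"
        if "x \<in> V" "y \<in> V" "lab x = lab y" for x y
        using that lab(1) mono by (auto simp: labels_def)
      have "path_component (drawn (insert e E')) (pos x) (pos y)"
        if xy: "x \<in> V" "y \<in> V" "lab' x = lab' y" for x y
      proof -
        consider "lab x = lab y" | "lab x = lab u" "lab y = lab v" | "lab x = lab v" "lab y = lab u"
          using xy unfolding lab'_def by (metis (full_types))
        then show ?thesis
        proof cases
          case 2
          then show ?thesis using pc uv' xy uv path_component_trans by metis
        next
          case 3
          then show ?thesis using pc uv' xy uv path_component_trans by metis
        qed (use pc xy in auto)
      qed
      moreover have "lab' x = lab' y" if "{x, y} \<in> insert e E'" for x y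
        using that lab(1) uv by (auto simp: lab'_def labels_def doubleton_eq_iff)
      ultimately have "labels (insert e E') lab'"
        by (auto simp: labels_def)
      moreover have "card (arc_attached.sides (drawn E') (\<gamma> e)) = 1" "finite (arc_attached.sides (drawn E') (\<gamma> e))"
        using sides_bridge[of E' u v lab] e lab False uv by (auto simp: labels_def)
      moreover have "lab' ` V = lab ` V - {lab u}"
        using False uv by (auto simp: lab'_def)
      then have "card (lab' ` V) + 1 = card (lab ` V)"
        using uv finite_V card_Suc_Diff1[of "lab ` V" "lab u"] by simp
      ultimately show ?thesis
        using card_faces_insert[OF e lab(2)] lab(3) insert(1,2) by (intro exI[of _ lab']) auto
    qed
  qed
qed

lemma finite_faces: "E' \<subseteq> E \<Longrightarrow> finite (faces E')"
  using Euler_labels by blast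

text \<open>The number of labels is only bounded below by 1, which turns Euler's formula into an
  inequality.\<close>

lemma Euler: "card E + 2 \<le> card (faces E) + card V"
proof -
  obtain lab :: "'a \<Rightarrow> 'a" where "card (faces E) + card V = card E + 1 + card (lab ` V)"
    using Euler_labels[OF order_refl] by blast
  moreover have "card (lab ` V) > 0"
    using finite_V V_nonempty card_gt_0_iff by blast
  ultimately show ?thesis by linarith
qed

section \<open>Incidences between faces and edges\<close>

definition touches :: "complex set \<Rightarrow> 'a set \<Rightarrow> bool" where
  "touches H e \<longleftrightarrow> closure H \<inter> (path_image (\<gamma> e) - pos ` V) \<noteq> {}"

text \<open>The edge is erased and drawn again as the last one. Every face touching it is then one
  of the at most two sides it creates.\<close>

lemma card_faces_touching:
  assumes "e \<in> E"
  shows "card {H \<in> faces E. touches H e} \<le> 2"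
proof -
  have e: "E - {e} \<subseteq> E" "e \<in> E" "e \<notin> E - {e}" using assms by auto
  interpret arc_attached "drawn (E - {e})" "\<gamma> e"
    using attached[OF e] .
  obtain lab where lab: "labels (E - {e}) lab"
    using Euler_labels[OF e(1)] by blast
  obtain u v where uv: "e = {u, v}" using edgeE[OF assms] by metis
  have s: "card sides \<le> 2 \<and> finite sides"
  proof (cases "lab u = lab v")
    case True
    then show ?thesis using sides_cycle[of "E - {e}" u v lab] e lab uv by auto
  next
    case False
    then show ?thesis using sides_bridge[of "E - {e}" u v lab] e lab uv by (auto simp: labels_def)
  qed
  have "drawn E = drawn (E - {e}) \<union> path_image (\<gamma> e)"
    using drawn_insert[of e "E - {e}"] assms by (simp add: insert_absorb)
  then have "{H \<in> faces E. touches H e} \<subseteq> sides"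
    using touching_component_in_sides edge_minus_drawn[OF e] by (auto simp: faces_def touches_def)
  then have "card {H \<in> faces E. touches H e} \<le> card sides"
    using s by (simp add: card_mono)
  then show ?thesis using s by linarith
qed

end

section \<open>Bipartite plane drawings\<close>

text \<open>Otherwise every end of an edge has a second edge. Extending \<open>{a, b}\<close> at
  \<open>a\<close>, at \<open>b\<close> and again at \<open>a'\<close> gives the walk
  \<open>b' a b a' b''\<close>, whose four edges are distinct even if \<open>b'\<close> and
  \<open>b''\<close> coincide.\<close>

lemma bipartite_leaf:
  assumes edges: "\<And>e. e \<in> E' \<Longrightarrow> \<exists>u v. e = {u, v} \<and> side u \<and> \<not> side v"
    and E': "E' \<noteq> {}" "finite E'" "card E' \<le> 3"
  shows "\<exists>u v. {u, v} \<in> E' \<and> u \<noteq> v \<and> (\<forall>e\<in>E'. u \<in> e \<longrightarrow> e = {u, v})"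
proof (rule ccontr)
  assume none: "\<not> ?thesis"
  have other: "\<exists>w. {u, w} \<in> E' \<and> w \<noteq> v \<and> side w = side v" if uv: "{u, v} \<in> E'" "side u \<noteq> side v" for u v
  proof -
    have "\<exists>e\<in>E'. u \<in> e \<and> e \<noteq> {u, v}"
      using none uv by metis
    then obtain e where e: "e \<in> E'" "u \<in> e" "e \<noteq> {u, v}" by blast
    then obtain a b where "e = {a, b}" "side a" "\<not> side b"
      using edges by blast
    then show ?thesis
      using e uv by (cases "u = a") (auto simp: insert_commute)
  qed
  obtain a b where ab: "{a, b} \<in> E'" "side a" "\<not> side b"
    using E'(1) edges by blast
  then obtain b' where b': "{a, b'} \<in> E'" "b' \<noteq> b" "\<not> side b'"
    using other[of a b] by auto
  obtain a' where a': "{b, a'} \<in> E'" "a' \<noteq> a" "side a'"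
    using other[of b a] ab by (auto simp: insert_commute)
  obtain b'' where b'': "{a', b''} \<in> E'" "b'' \<noteq> b" "\<not> side b''"
    using other[of a' b] a' ab by (auto simp: insert_commute)
  have "{{a, b}, {a, b'}, {b, a'}, {a', b''}} \<subseteq> E'"
    using ab a' b' b'' by auto
  moreover have "card {{a, b}, {a, b'}, {b, a'}, {a', b''}} = 4"
  proof -
    have "a \<noteq> b" "a \<noteq> b'" "a \<noteq> b''" "a' \<noteq> b" "a' \<noteq> b'"
      using ab a' b' b'' by metis+
    then have "{a, b} \<noteq> {a, b'}" "{a, b} \<noteq> {b, a'}" "{a, b} \<noteq> {a', b''}" "{a, b'} \<noteq> {b, a'}"
      "{a, b'} \<noteq> {a', b''}" "{b, a'} \<noteq> {a', b''}"
      using \<open>b' \<noteq> b\<close> \<open>a' \<noteq> a\<close> \<open>b'' \<noteq> b\<close> by (simp_all add: doubleton_eq_iff)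
    then show ?thesis by simp
  qed
  ultimately show False
    using E' card_mono[of E' "{{a, b}, {a, b'}, {b, a'}, {a', b''}}"] by simp
qed

locale bipartite_plane_drawing = plane_drawing +
  fixes side :: "'a \<Rightarrow> bool"
  assumes bipartite: "\<And>u v. {u, v} \<in> E \<Longrightarrow> side u \<noteq> side v"
begin

lemma bipartite_edge: "e \<in> E \<Longrightarrow> \<exists>u v. e = {u, v} \<and> side u \<and> \<not> side v"
  by (metis bipartite edgeE insert_commute)

text \<open>By induction, removing a leaf edge: put back, it is a bridge and does not split the
  single face.\<close>

lemma card_faces_few_edges:
  assumes "E' \<subseteq> E" "card E' \<le> 3"
  shows "card (faces E') = 1"
  using assms
proof (induction "card E'" arbitrary: E')
  case 0
  then have "E' = {}"
    using finite_E finite_subset by fastforce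
  moreover have "faces {} = {- drawn {}}"
    unfolding faces_def components_eq_sing_iff using connected_Compl_vertices by blast
  ultimately show ?case by simp
next
  case (Suc n)
  have fin: "finite E'" using Suc.prems finite_E finite_subset by blast
  have "\<exists>u v. e = {u, v} \<and> side u \<and> \<not> side v" if "e \<in> E'" for e
    using bipartite_edge[of e] Suc.prems(1) that by (meson subsetD)
  moreover have "E' \<noteq> {}" using Suc.hyps(2) by auto
  ultimately have "\<exists>u v. {u, v} \<in> E' \<and> u \<noteq> v \<and> (\<forall>e\<in>E'. u \<in> e \<longrightarrow> e = {u, v})"
    using fin Suc.prems(2) by (intro bipartite_leaf[of E' side])
  then obtain u v where uv: "{u, v} \<in> E'" "u \<noteq> v" "\<forall>e\<in>E'. u \<in> e \<longrightarrow> e = {u, v}"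
    by blast
  define E'' where "E'' = E' - {{u, v}}"
  have E'': "E'' \<subseteq> E" "{u, v} \<in> E" "{u, v} \<notin> E''" "insert {u, v} E'' = E'" "card E'' = n"
    using uv(1) Suc.prems(1) Suc.hyps(2) fin by (auto simp: E''_def)
  have one: "card (faces E'') = 1"
    using Suc.hyps(1)[of E''] E'' Suc.hyps(2) Suc.prems by simp
  \<comment> \<open>The leaf \<open>u\<close> is isolated in \<open>E''\<close>, so the labelling
    that separates it from everything else is constant along edges.\<close>
  define lab where "lab x = (if x = u then u else v)" for x
  have "lab x = lab y" if "{x, y} \<in> E''" for x y
    using that uv(3) by (auto simp: E''_def lab_def)
  moreover have "lab u \<noteq> lab v" using uv by (simp add: lab_def)
  ultimately have "card (arc_attached.sides (drawn E'') (\<gamma> {u, v})) = 1"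
    "finite (arc_attached.sides (drawn E'') (\<gamma> {u, v}))"
    using sides_bridge[OF E''(1-3), of lab] by blast+
  then show ?case
    using card_faces_insert[OF E''(1-3) finite_faces[OF E''(1)]] one E'' by simp
qed

text \<open>The frontier of \<open>H\<close> lies in the drawing of the edges that \<open>H\<close>
  touches, together with the vertices. If these edges are at most three, the complement of that
  drawing is connected and avoids the frontier, so it is contained in \<open>H\<close>. It also
  contains every other face, so \<open>H\<close> would be the only one.\<close>

lemma face_touches_four:
  assumes "card (faces E) \<ge> 2" "H \<in> faces E"
  shows "card {e \<in> E. touches H e} \<ge> 4"
proof (rule ccontr)
  define EH where "EH = {e \<in> E. touches H e}"
  assume "\<not> ?thesis"
  then have EH: "EH \<subseteq> E" "card EH \<le> 3" by (auto simp: EH_def)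
  have clE: "closed (drawn E)" using compact_drawn compact_imp_closed by blast
  have H: "H \<noteq> {}" "H \<subseteq> - drawn E" "connected H"
    using assms(2) unfolding faces_def in_components_maximal by auto
  have HEH: "H \<subseteq> - drawn EH" using H drawn_mono[OF EH(1)] by blast
  have fr: "frontier H \<subseteq> drawn EH"
  proof
    fix z assume z: "z \<in> frontier H"
    then have zE: "z \<in> drawn E"
      using frontier_of_components_closed_complement[OF clE] assms(2) by (auto simp: faces_def)
    show "z \<in> drawn EH"
    proof (cases "z \<in> pos ` V")
      case False
      then obtain e where "e \<in> E" "z \<in> path_image (\<gamma> e)"
        using zE by (auto simp: drawn_def)
      moreover have "touches H e"
        using z False calculation by (auto simp: touches_def frontier_def)
      ultimately show ?thesis by (auto simp: drawn_def EH_def)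
    qed (simp add: drawn_def)
  qed
  obtain S where S: "faces EH = {S}"
    using card_faces_few_edges[OF EH] card_1_singletonE by blast
  then have S': "S = - drawn EH" "connected S"
    unfolding faces_def using components_eq_sing_exists[of "- drawn EH"] components_eq_sing_iff[of "- drawn EH"] by auto
  have "S \<subseteq> H"
  proof (rule ccontr)
    assume "\<not> S \<subseteq> H"
    then have "S \<inter> frontier H \<noteq> {}"
      using S' H HEH by (intro connected_Int_frontier) auto
    then show False using fr S' by blast
  qed
  have "H' = H" if "H' \<in> faces E" for H'
  proof -
    have "H' \<noteq> {}" "H' \<subseteq> - drawn E"
      using that by (auto simp: faces_def in_components_nonempty dest: in_components_subset)
    then have "H' \<inter> H \<noteq> {}"
      using \<open>S \<subseteq> H\<close> S' drawn_mono[OF EH(1)] by blast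
    then show ?thesis
      using that assms(2) unfolding faces_def by (metis components_nonoverlap)
  qed
  then have "faces E \<subseteq> {H}" by blast
  then have "card (faces E) \<le> 1"
    using card_mono[of "{H}" "faces E"] by simp
  then show False using assms(1) by simp
qed

text \<open>With at least two faces, counting touching pairs of faces and edges gives
  \<open>4 * card (faces E) \<le> 2 * card E\<close>, and \<open>Euler\<close> yields the second
  alternative. With at most one face, \<open>Euler\<close> yields the first.\<close>

lemma card_edges_le: "card E + 1 \<le> card V \<or> card E + 4 \<le> 2 * card V"
proof (cases "card (faces E) \<ge> 2")
  case True
  have "4 * card (faces E) = (\<Sum>H\<in>faces E. 4)" by simp
  also have "\<dots> \<le> (\<Sum>H\<in>faces E. card {e \<in> E. touches H e})"
    using face_touches_four True by (intro sum_mono) auto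
  also have "\<dots> = (\<Sum>H\<in>faces E. \<Sum>e\<in>E. if touches H e then 1 else 0)"
    using finite_E by (simp add: sum.If_cases Int_def)
  also have "\<dots> = (\<Sum>e\<in>E. \<Sum>H\<in>faces E. if touches H e then 1 else 0)"
    by (rule sum.swap)
  also have "\<dots> = (\<Sum>e\<in>E. card {H \<in> faces E. touches H e})"
    using finite_faces[OF order_refl] by (simp add: sum.If_cases Int_def)
  also have "\<dots> \<le> (\<Sum>e\<in>E. 2)"
    using card_faces_touching by (intro sum_mono) auto
  finally show ?thesis using Euler by simp
next
  case False
  then show ?thesis using Euler by simp
qed

end

text \<open>A bound \<open>N\<close> stands in for \<open>card V\<close> because a subgraph in a
  cover may have fewer vertices. As \<open>N\<close> is at least 4, the alternative
  \<open>card E + 1 \<le> card V\<close> implies the same bound.\<close>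

lemma planar_bipartite_card_edges_le:
  fixes side :: "'a \<Rightarrow> bool"
  assumes "planar V E" "simple_graph V E" "\<And>u v. {u, v} \<in> E \<Longrightarrow> side u \<noteq> side v"
    and "card V \<le> N" "4 \<le> N"
  shows "card E + 4 \<le> 2 * N"
proof (cases "V = {}")
  case True
  then have "E = {}" using assms(2) by (auto simp: simple_graph_def)
  then show ?thesis using assms by simp
next
  case False
  obtain pos :: "'a \<Rightarrow> complex" and \<gamma> where d: "inj_on pos V"
     "\<forall>e\<in>E. arc (\<gamma> e) \<and> {pathstart (\<gamma> e), pathfinish (\<gamma> e)} = pos ` e \<and>
              path_image (\<gamma> e) \<inter> pos ` V = pos ` e"
     "\<forall>e\<in>E. \<forall>e'\<in>E. e \<noteq> e' \<longrightarrow> path_image (\<gamma> e) \<inter> path_image (\<gamma> e') \<subseteq> pos ` (e \<inter> e')"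
    using assms(1) unfolding planar_def by blast
  interpret bipartite_plane_drawing V E pos \<gamma> side
    using assms(2,3) False d by unfold_locales simp_all
  show ?thesis using card_edges_le assms(4,5) by linarith
qed

section \<open>Straight-line drawings\<close>

text \<open>Disjoint cells turn geometry into bookkeeping: once each vertex and each open edge lies
  in a cell of its own, absence of crossings is injectivity of the codes \<open>vc\<close> and
  \<open>ec\<close>.\<close>

lemma planar_straight_line:
  fixes pos :: "'a \<Rightarrow> complex" and cell :: "'c \<Rightarrow> complex set"
  assumes disj: "\<And>c d z. z \<in> cell c \<Longrightarrow> z \<in> cell d \<Longrightarrow> c = d"
    and vert: "\<And>v. v \<in> V \<Longrightarrow> pos v \<in> cell (vc v)" and inj_vc: "inj_on vc V"
    and ends: "\<And>u v. (u, v) \<in> A \<Longrightarrow> u \<in> V \<and> v \<in> V \<and> u \<noteq> v"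
    and seg: "\<And>u v. (u, v) \<in> A \<Longrightarrow> open_segment (pos u) (pos v) \<subseteq> cell (ec u v)"
    and notin: "\<And>u v. (u, v) \<in> A \<Longrightarrow> ec u v \<notin> vc ` V"
    and inj_ec: "\<And>u v u' v'. (u, v) \<in> A \<Longrightarrow> (u', v') \<in> A \<Longrightarrow> ec u v = ec u' v' \<Longrightarrow> {u, v} = {u', v'}"
  shows "planar V {{u, v} | u v. (u, v) \<in> A}"
proof -
  have inj: "inj_on pos V"
    by (rule inj_onI) (metis disj vert inj_vc inj_onD)
  \<comment> \<open>Edges are unordered, so a pair in \<open>A\<close> is chosen to direct the
    segment.\<close>
  define orient where "orient e = (SOME p. p \<in> A \<and> e = {fst p, snd p})" for e
  define \<gamma> where "\<gamma> e = linepath (pos (fst (orient e))) (pos (snd (orient e)))" for e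
  have o: "\<exists>u v. (u, v) \<in> A \<and> e = {u, v} \<and> \<gamma> e = linepath (pos u) (pos v) \<and>
      path_image (\<gamma> e) = open_segment (pos u) (pos v) \<union> pos ` e" if "e \<in> {{u, v} | u v. (u, v) \<in> A}" for e
  proof -
    have "\<exists>p. p \<in> A \<and> e = {fst p, snd p}" using that by force
    then have "orient e \<in> A \<and> e = {fst (orient e), snd (orient e)}"
      unfolding orient_def by (rule someI_ex)
    then obtain u v where "(u, v) \<in> A" "e = {u, v}" "orient e = (u, v)"
      by (metis prod.collapse)
    then show ?thesis
      by (intro exI[of _ u] exI[of _ v]) (auto simp: \<gamma>_def closed_segment_eq_open)
  qed
  have seg_V: "open_segment (pos u) (pos v) \<inter> pos ` V = {}" if "(u, v) \<in> A" for u v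
  proof (rule ccontr)
    assume "\<not> ?thesis"
    then obtain w where "w \<in> V" "pos w \<in> open_segment (pos u) (pos v)" by auto
    then have "ec u v = vc w"
      using disj[of "pos w"] vert[of w] seg[OF that] by blast
    then show False using notin[OF that] \<open>w \<in> V\<close> by auto
  qed
  show ?thesis
    unfolding planar_def
  proof (intro exI[of _ pos] exI[of _ \<gamma>] conjI ballI impI)
    show "inj_on pos V" by (rule inj)
  next
    fix e assume e: "e \<in> {{u, v} | u v. (u, v) \<in> A}"
    obtain u v where uv: "(u, v) \<in> A" "e = {u, v}" "\<gamma> e = linepath (pos u) (pos v)"
      "path_image (\<gamma> e) = open_segment (pos u) (pos v) \<union> pos ` e"
      using o[OF e] by blast
    have uvV: "u \<in> V" "v \<in> V" "u \<noteq> v" using ends uv by auto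
    then have "pos u \<noteq> pos v" using inj_onD[OF inj] by metis
    then show "arc (\<gamma> e)" using uv by (simp add: arc_linepath)
    show "{pathstart (\<gamma> e), pathfinish (\<gamma> e)} = pos ` e" using uv by simp
    show "path_image (\<gamma> e) \<inter> pos ` V = pos ` e"
      unfolding uv(4) using seg_V[OF uv(1)] uv(2) uvV by blast
  next
    fix e e' assume e: "e \<in> {{u, v} | u v. (u, v) \<in> A}" and e': "e' \<in> {{u, v} | u v. (u, v) \<in> A}"
      and ne: "e \<noteq> e'"
    obtain u v u' v' where
      uv: "(u, v) \<in> A" "e = {u, v}" "path_image (\<gamma> e) = open_segment (pos u) (pos v) \<union> pos ` e" and
      uv': "(u', v') \<in> A" "e' = {u', v'}" "path_image (\<gamma> e') = open_segment (pos u') (pos v') \<union> pos ` e'"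
      using o[OF e] o[OF e'] by blast
    have "ec u v \<noteq> ec u' v'" using inj_ec[OF uv(1) uv'(1)] ne uv uv' by auto
    then have "open_segment (pos u) (pos v) \<inter> open_segment (pos u') (pos v') = {}"
      using seg[OF uv(1)] seg[OF uv'(1)] disj by blast
    moreover have eV: "e \<subseteq> V" "e' \<subseteq> V" using ends uv uv' by auto
    moreover have "pos ` e \<inter> pos ` e' = pos ` (e \<inter> e')"
      using inj_on_image_Int[OF inj eV] by simp
    ultimately show "path_image (\<gamma> e) \<inter> path_image (\<gamma> e') \<subseteq> pos ` (e \<inter> e')"
      unfolding uv(3) uv'(3) using seg_V[OF uv(1)] seg_V[OF uv'(1)] by blast
  qed
qed

section \<open>Cells for the drawing of one layer\<close>

datatype kind = InnerV | OuterV | Spoke | InnerE | OuterE | InsV | InsInnerE | InsOuterE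

text \<open>In sector coordinates the gap between the squares is the quadrilateral with corners
  (1,0), (3,0), (0,3), (0,1). Inserted vertices lie on the diagonal from (1,0) to (0,3), the line
  \<open>3 * x + y = 3\<close>, and are joined to (0,1) and (3,0). The last two equations describe
  the lines through these corners and the inserted vertex with parameter \<open>t\<close>.\<close>

fun region :: "kind \<Rightarrow> real \<Rightarrow> real \<Rightarrow> real \<Rightarrow> bool" where
  "region InnerV t x y \<longleftrightarrow> t = 0 \<and> x = 1 \<and> y = 0"
| "region OuterV t x y \<longleftrightarrow> t = 0 \<and> x = 3 \<and> y = 0"
| "region Spoke t x y \<longleftrightarrow> t = 0 \<and> 1 < x \<and> x < 3 \<and> y = 0"
| "region InnerE t x y \<longleftrightarrow> t = 0 \<and> x + y = 1 \<and> y > 0"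
| "region OuterE t x y \<longleftrightarrow> t = 0 \<and> x + y = 3 \<and> y > 0"
| "region InsV t x y \<longleftrightarrow> 0 < t \<and> t < 1 \<and> x = 1 - t \<and> y = 3 * t"
| "region InsInnerE t x y \<longleftrightarrow> t * (3 * x + y - 1) = x + y - 1 \<and> 3 * x + y < 3 \<and> 1 < x + y \<and> y > 0"
| "region InsOuterE t x y \<longleftrightarrow> t * (9 - 3 * x - y) = 2 * y \<and> 3 < 3 * x + y \<and> x + y < 3 \<and> y > 0"

text \<open>The linear constraints of different kinds exclude each other. For inserted edges the
  coefficient of \<open>t\<close> is positive, so the point determines \<open>t\<close>.\<close>

lemma region_unique:
  assumes "region a t x y" "region b s x y" "x > 0"
  shows "a = b \<and> t = s"
proof -
  have "a = b"
    using assms by (cases a; cases b) auto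
  moreover have "t = s"
  proof (cases a)
    case InsInnerE
    then have "(t - s) * (3 * x + y - 1) = 0" "3 * x + y - 1 \<noteq> 0"
      using assms \<open>a = b\<close> by (auto simp: algebra_simps)
    then show ?thesis by simp
  next
    case InsOuterE
    then have "(t - s) * (9 - 3 * x - y) = 0" "9 - 3 * x - y \<noteq> 0"
      using assms \<open>a = b\<close> by (auto simp: algebra_simps)
    then show ?thesis by simp
  qed (use assms \<open>a = b\<close> in auto)
  ultimately show ?thesis by simp
qed

text \<open>
  The four rotated copies of the sector \<open>x > 0\<close>, \<open>y \<ge> 0\<close> tile the punctured plane, so a cell is
  determined by any of its points.
\<close>

fun cell :: "nat \<times> kind \<times> real \<Rightarrow> complex set" where
  "cell (k, a, t) = {\<i> ^ k * Complex x y | x y. k < 4 \<and> x > 0 \<and> y \<ge> 0 \<and> region a t x y}"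

lemma less_4_cases: "(k::nat) < 4 \<longleftrightarrow> k = 0 \<or> k = 1 \<or> k = 2 \<or> k = 3"
  by auto

lemma rotated_sector_unique:
  assumes "\<i> ^ k * Complex x y = \<i> ^ l * Complex x' y'" "k < 4" "l < 4" "x > 0" "y \<ge> 0" "x' > 0" "y' \<ge> 0"
  shows "k = l \<and> x = x' \<and> y = y'"
  using assms unfolding less_4_cases
  by (elim disjE) (simp_all add: complex_eq_iff power3_eq_cube)

lemma cell_unique:
  assumes "z \<in> cell c" "z \<in> cell d" shows "c = d"
proof -
  obtain k a t l b s where c: "c = (k, a, t)" "d = (l, b, s)"
    by (metis prod.collapse)
  obtain x y where x: "z = \<i> ^ k * Complex x y" "k < 4" "x > 0" "y \<ge> 0" "region a t x y"
    using assms(1) c by auto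
  obtain x' y' where x': "z = \<i> ^ l * Complex x' y'" "l < 4" "x' > 0" "y' \<ge> 0" "region b s x' y'"
    using assms(2) c by auto
  have "k = l \<and> x = x' \<and> y = y'"
    using rotated_sector_unique[of k x y l x' y'] x x' by simp
  then show ?thesis using region_unique[of a t x y b s] x x' c by simp
qed

text \<open>Only vertex codes are placed; the default branch serves \<open>InsV\<close>.\<close>

fun point :: "nat \<times> kind \<times> real \<Rightarrow> complex" where
  "point (k, a, t) = \<i> ^ k * (case a of InnerV \<Rightarrow> 1 | OuterV \<Rightarrow> 3 | _ \<Rightarrow> Complex (1 - t) (3 * t))"

lemma segment_rotate:
  assumes "\<And>s. 0 < s \<Longrightarrow> s < 1 \<Longrightarrow> (1 - s) * x1 + s * x2 > 0 \<and> (1 - s) * y1 + s * y2 \<ge> 0 \<and>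
      region a t ((1 - s) * x1 + s * x2) ((1 - s) * y1 + s * y2)"
    and "k < 4" "p = \<i> ^ k * Complex x1 y1" "q = \<i> ^ k * Complex x2 y2"
  shows "open_segment p q \<subseteq> cell (k, a, t)"
proof
  fix z assume "z \<in> open_segment p q"
  then obtain s where s: "0 < s" "s < 1" "z = (1 - s) *\<^sub>R p + s *\<^sub>R q"
    by (auto simp: in_segment)
  have "(1 - s) *\<^sub>R p + s *\<^sub>R q = \<i> ^ k * ((1 - s) *\<^sub>R Complex x1 y1 + s *\<^sub>R Complex x2 y2)"
    unfolding assms(3,4) by (simp only: distrib_left mult_scaleR_right)
  also have "(1 - s) *\<^sub>R Complex x1 y1 + s *\<^sub>R Complex x2 y2 = Complex ((1 - s) * x1 + s * x2) ((1 - s) * y1 + s * y2)"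
    by (simp add: complex_eq_iff)
  finally show "z \<in> cell (k, a, t)"
    using assms(1)[OF s(1,2)] assms(2) s(3) by auto
qed

text \<open>Writes the corners as rotated sector coordinates: the next corner of a square lies on
  the y-axis of sector \<open>k\<close>.\<close>

lemma rot_Suc: "\<i> ^ Suc k = \<i> ^ k * Complex 0 1" "3 * \<i> ^ Suc k = \<i> ^ k * Complex 0 3"
    "\<i> ^ k = \<i> ^ k * Complex 1 0" "3 * \<i> ^ k = \<i> ^ k * Complex 3 0"
  by (simp_all add: complex_eq_iff)

lemma segment_InnerE: "k < 4 \<Longrightarrow> open_segment (\<i> ^ k) (\<i> ^ Suc k) \<subseteq> cell (k, InnerE, 0)"
  by (rule segment_rotate[OF _ _ rot_Suc(3) rot_Suc(1)]) auto

lemma segment_OuterE: "k < 4 \<Longrightarrow> open_segment (3 * \<i> ^ k) (3 * \<i> ^ Suc k) \<subseteq> cell (k, OuterE, 0)"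
  by (rule segment_rotate[OF _ _ rot_Suc(4) rot_Suc(2)]) auto

lemma segment_Spoke: "k < 4 \<Longrightarrow> open_segment (\<i> ^ k) (3 * \<i> ^ k) \<subseteq> cell (k, Spoke, 0)"
  by (rule segment_rotate[OF _ _ rot_Suc(3) rot_Suc(4)]) auto

lemma segment_InsInnerE:
  assumes "k < 4" "0 < t" "t < 1"
  shows "open_segment (\<i> ^ k * Complex (1 - t) (3 * t)) (\<i> ^ Suc k) \<subseteq> cell (k, InsInnerE, t)"
proof (rule segment_rotate[OF _ assms(1) refl rot_Suc(1)])
  fix s :: real assume s: "0 < s" "s < 1"
  \<comment> \<open>With these weights of the convex combination all conditions become linear, apart
    from the single relation \<open>t * (p + q) = p\<close>.\<close>
  define p q where "p = (1 - s) * t" and "q = (1 - s) * (1 - t)"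
  have s_eq: "s = 1 - (p + q)" and tp: "t * (p + q) = p"
    by (simp_all add: p_def q_def algebra_simps)
  have "p > 0" "q > 0"
    using s assms by (simp_all add: p_def q_def)
  moreover have "p + q < 1" using s s_eq by linarith
  ultimately have pq: "p > 0" "q > 0" "p + q < 1" "t * (p + q) = p"
    using tp by auto
  have eq: "(1 - s) * (1 - t) + s * 0 = q" "(1 - s) * (3 * t) + s * 1 = 3 * p + 1 - (p + q)"
    by (simp_all add: p_def q_def algebra_simps)
  have "t * (3 * q + (3 * p + 1 - (p + q)) - 1) = 2 * (t * (p + q))"
    by (simp add: algebra_simps)
  then show "0 < (1 - s) * (1 - t) + s * 0 \<and> 0 \<le> (1 - s) * (3 * t) + s * 1 \<and>
      region InsInnerE t ((1 - s) * (1 - t) + s * 0) ((1 - s) * (3 * t) + s * 1)"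
    unfolding eq using pq by simp
qed

lemma segment_InsOuterE:
  assumes "k < 4" "0 < t" "t < 1"
  shows "open_segment (\<i> ^ k * Complex (1 - t) (3 * t)) (3 * \<i> ^ k) \<subseteq> cell (k, InsOuterE, t)"
proof (rule segment_rotate[OF _ assms(1) refl rot_Suc(4)])
  fix s :: real assume s: "0 < s" "s < 1"
  define p q where "p = (1 - s) * t" and "q = (1 - s) * (1 - t)"
  have s_eq: "s = 1 - (p + q)" and tp: "t * (p + q) = p"
    by (simp_all add: p_def q_def algebra_simps)
  have "p > 0" "q > 0"
    using s assms by (simp_all add: p_def q_def)
  moreover have "p + q < 1" using s s_eq by linarith
  ultimately have pq: "p > 0" "q > 0" "p + q < 1" "t * (p + q) = p"
    using tp by auto
  have eq: "(1 - s) * (1 - t) + s * 3 = 3 - 3 * p - 2 * q" "(1 - s) * (3 * t) + s * 0 = 3 * p"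
    by (simp_all add: p_def q_def algebra_simps)
  have "t * (9 - 3 * (3 - 3 * p - 2 * q) - 3 * p) = 6 * (t * (p + q))"
    by (simp add: algebra_simps)
  then show "0 < (1 - s) * (1 - t) + s * 3 \<and> 0 \<le> (1 - s) * (3 * t) + s * 0 \<and>
      region InsOuterE t ((1 - s) * (1 - t) + s * 3) ((1 - s) * (3 * t) + s * 0)"
    unfolding eq using pq by simp
qed

lemma rot_mod_4: "k < 4 \<Longrightarrow> \<i> ^ (Suc k mod 4) = \<i> ^ Suc k"
  unfolding less_4_cases by (elim disjE) (simp_all add: power3_eq_cube power4_eq_xxxx)

lemma segments:
  assumes "k < 4"
  shows "l = Suc k mod 4 \<Longrightarrow> open_segment (point (k, InnerV, 0)) (point (l, InnerV, 0)) \<subseteq> cell (k, InnerE, 0)"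
    "l = Suc k mod 4 \<Longrightarrow> open_segment (point (k, OuterV, 0)) (point (l, OuterV, 0)) \<subseteq> cell (k, OuterE, 0)"
    "open_segment (point (k, InnerV, 0)) (point (k, OuterV, 0)) \<subseteq> cell (k, Spoke, 0)"
    "l = Suc k mod 4 \<Longrightarrow> 0 < t \<Longrightarrow> t < 1 \<Longrightarrow>
      open_segment (point (k, InsV, t)) (point (l, InnerV, 0)) \<subseteq> cell (k, InsInnerE, t)"
    "0 < t \<Longrightarrow> t < 1 \<Longrightarrow> open_segment (point (k, InsV, t)) (point (k, OuterV, 0)) \<subseteq> cell (k, InsOuterE, t)"
proof -
  have p: "point (k, InnerV, 0) = \<i> ^ k" "point (k, OuterV, 0) = 3 * \<i> ^ k"
    "point (k, InsV, t) = \<i> ^ k * Complex (1 - t) (3 * t)" for k t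
    by simp_all
  show "l = Suc k mod 4 \<Longrightarrow> open_segment (point (k, InnerV, 0)) (point (l, InnerV, 0)) \<subseteq> cell (k, InnerE, 0)"
    "l = Suc k mod 4 \<Longrightarrow> open_segment (point (k, OuterV, 0)) (point (l, OuterV, 0)) \<subseteq> cell (k, OuterE, 0)"
    "open_segment (point (k, InnerV, 0)) (point (k, OuterV, 0)) \<subseteq> cell (k, Spoke, 0)"
    "l = Suc k mod 4 \<Longrightarrow> 0 < t \<Longrightarrow> t < 1 \<Longrightarrow>
      open_segment (point (k, InsV, t)) (point (l, InnerV, 0)) \<subseteq> cell (k, InsInnerE, t)"
    "0 < t \<Longrightarrow> t < 1 \<Longrightarrow> open_segment (point (k, InsV, t)) (point (k, OuterV, 0)) \<subseteq> cell (k, InsOuterE, t)"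
    using segment_InnerE[OF assms] segment_OuterE[OF assms] segment_Spoke[OF assms]
      segment_InsInnerE[OF assms, of t] segment_InsOuterE[OF assms, of t]
    by (simp_all only: p rot_mod_4[OF assms])
qed

text \<open>Product edges are directed from the \<open>False\<close> to the \<open>True\<close>
  copy, which may run against the direction used in \<open>segments\<close>.\<close>

lemma segments_commute:
  assumes "k < 4"
  shows "l = Suc k mod 4 \<Longrightarrow> open_segment (point (l, InnerV, 0)) (point (k, InnerV, 0)) \<subseteq> cell (k, InnerE, 0)"
    "l = Suc k mod 4 \<Longrightarrow> open_segment (point (l, OuterV, 0)) (point (k, OuterV, 0)) \<subseteq> cell (k, OuterE, 0)"
    "open_segment (point (k, OuterV, 0)) (point (k, InnerV, 0)) \<subseteq> cell (k, Spoke, 0)"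
    "l = Suc k mod 4 \<Longrightarrow> 0 < t \<Longrightarrow> t < 1 \<Longrightarrow>
      open_segment (point (l, InnerV, 0)) (point (k, InsV, t)) \<subseteq> cell (k, InsInnerE, t)"
    "0 < t \<Longrightarrow> t < 1 \<Longrightarrow> open_segment (point (k, OuterV, 0)) (point (k, InsV, t)) \<subseteq> cell (k, InsOuterE, t)"
proof -
  have c: "open_segment a b \<subseteq> S \<Longrightarrow> open_segment b a \<subseteq> S" for a b :: complex and S
    by (subst open_segment_commute)
  show "l = Suc k mod 4 \<Longrightarrow> open_segment (point (l, InnerV, 0)) (point (k, InnerV, 0)) \<subseteq> cell (k, InnerE, 0)"
    by (rule c) (rule segments[OF assms])
  show "l = Suc k mod 4 \<Longrightarrow> open_segment (point (l, OuterV, 0)) (point (k, OuterV, 0)) \<subseteq> cell (k, OuterE, 0)"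
    by (rule c) (rule segments[OF assms])
  show "open_segment (point (k, OuterV, 0)) (point (k, InnerV, 0)) \<subseteq> cell (k, Spoke, 0)"
    by (rule c) (rule segments[OF assms])
  show "l = Suc k mod 4 \<Longrightarrow> 0 < t \<Longrightarrow> t < 1 \<Longrightarrow>
      open_segment (point (l, InnerV, 0)) (point (k, InsV, t)) \<subseteq> cell (k, InsInnerE, t)"
    by (rule c) (rule segments[OF assms])
  show "0 < t \<Longrightarrow> t < 1 \<Longrightarrow> open_segment (point (k, OuterV, 0)) (point (k, InsV, t)) \<subseteq> cell (k, InsOuterE, t)"
    by (rule c) (rule segments[OF assms])
qed

text \<open>
  The inner square is, in cyclic order, \<open>u\<^sub>0 v\<^sub>1 u\<^sub>3 v\<^sub>2\<close> and the outer one \<open>v\<^sub>3 u\<^sub>2 v\<^sub>0 u\<^sub>1\<close>, where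
  \<open>False\<close> stands for \<open>u\<close> and \<open>True\<close> for \<open>v\<close>. A vertex in sector \<open>k\<close> is attached to the inner corner
  \<open>k + 1\<close> and the outer corner \<open>k\<close>. The sectors are chosen such that the edges between two blocks
  which are missing in the layer of one block are exactly those present in the layer of the other.
\<close>

fun sector :: "bool \<Rightarrow> nat \<Rightarrow> nat" where
  "sector False j = (if j < 2 then 0 else 2)"
| "sector True j = (if odd j then 1 else 3)"

fun cube_vertex :: "bool \<Rightarrow> nat \<Rightarrow> nat \<times> kind \<times> real" where
  "cube_vertex False j = (if j = 0 then (0, InnerV, 0) else if j = 1 then (3, OuterV, 0)
     else if j = 2 then (1, OuterV, 0) else (2, InnerV, 0))"
| "cube_vertex True j = (if j = 0 then (2, OuterV, 0) else if j = 1 then (1, InnerV, 0)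
     else if j = 2 then (3, InnerV, 0) else (0, OuterV, 0))"

text \<open>The parameter \<open>1 / (real m + 2)\<close> lies strictly between 0 and 1 and is
  injective in \<open>m\<close>, so vertices in one sector stay apart.\<close>

definition vertex_code :: "nat \<Rightarrow> nat \<times> bool \<Rightarrow> nat \<times> kind \<times> real" where
  "vertex_code r = (\<lambda>(m, b). if m div 4 = r then cube_vertex b (m mod 4)
     else (sector b (m mod 4), InsV, 1 / (real m + 2)))"

text \<open>The final branch is meant for the one remaining pair, (1, 2).\<close>

definition cube_edge :: "nat \<Rightarrow> nat \<Rightarrow> nat \<times> kind \<times> real" where
  "cube_edge j j' =
    (if (j, j') = (0, 1) then (0, InnerE, 0) else if (j, j') = (3, 1) then (1, InnerE, 0)
     else if (j, j') = (3, 2) then (2, InnerE, 0) else if (j, j') = (0, 2) then (3, InnerE, 0)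
     else if (j, j') = (2, 3) then (0, OuterE, 0) else if (j, j') = (2, 0) then (1, OuterE, 0)
     else if (j, j') = (1, 0) then (2, OuterE, 0) else if (j, j') = (1, 3) then (3, OuterE, 0)
     else if (j, j') = (0, 3) then (0, Spoke, 0) else if (j, j') = (2, 1) then (1, Spoke, 0)
     else if (j, j') = (3, 0) then (2, Spoke, 0) else (3, Spoke, 0))"

text \<open>Here \<open>m\<close> indexes the \<open>False\<close> end and \<open>m'\<close> the
  \<open>True\<close> end. The sets {0, 3} and {1, 2} collect the residues whose
  \<open>False\<close>, respectively \<open>True\<close>, copy is an inner corner.\<close>

definition edge_code :: "nat \<Rightarrow> nat \<Rightarrow> nat \<Rightarrow> nat \<times> kind \<times> real" where
  "edge_code r m m' =
    (if m div 4 = r \<and> m' div 4 = r then cube_edge (m mod 4) (m' mod 4)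
     else if m div 4 = r
     then (sector True (m' mod 4), if m mod 4 \<in> {0, 3} then InsInnerE else InsOuterE, 1 / (real m' + 2))
     else (sector False (m mod 4), if m' mod 4 \<in> {1, 2} then InsInnerE else InsOuterE, 1 / (real m + 2)))"

text \<open>In the layer of the block of \<open>m\<close>, an inserted \<open>v\<close> of odd index
  is attached to \<open>u\<^sub>2\<close> and \<open>u\<^sub>3\<close>, one of even index to
  \<open>u\<^sub>0\<close> and \<open>u\<^sub>1\<close>; this is the test. If it fails, the edge
  occurs in the layer of \<open>m'\<close>, where an inserted \<open>u\<close> of residue 0 or 1 is
  attached to \<open>v\<^sub>1\<close> and \<open>v\<^sub>3\<close>, any other to
  \<open>v\<^sub>0\<close> and \<open>v\<^sub>2\<close>.\<close>

definition layer :: "nat \<Rightarrow> nat \<Rightarrow> nat" where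
  "layer m m' = (if m div 4 = m' div 4 then m div 4
     else if (m mod 4) div 2 = m' mod 2 then m div 4 else m' div 4)"

section \<open>Injectivity and correctness of the vertex and edge codes\<close>

lemma mod4_cases: "(m::nat) mod 4 = 0 \<or> m mod 4 = 1 \<or> m mod 4 = 2 \<or> m mod 4 = 3"
  by (metis less_4_cases mod_less_divisor zero_less_numeral)

lemma eq_iff_div_mod_4: "m = m' \<longleftrightarrow> m div 4 = m' div 4 \<and> m mod 4 = m' mod (4::nat)"
  by (metis div_mult_mod_eq)

text \<open>The two copies of an inserted vertex share a parameter but not a sector:
  \<open>False\<close> copies use even sectors, \<open>True\<close> copies odd ones.\<close>

lemma inj_vertex_code: "inj (vertex_code r)"
proof (rule injI)
  fix v v' :: "nat \<times> bool" assume "vertex_code r v = vertex_code r v'"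
  moreover obtain m b m' b' where v: "v = (m, b)" "v' = (m', b')" by (cases v; cases v')
  ultimately have eq: "vertex_code r (m, b) = vertex_code r (m', b')" by simp
  have bb: "b = b'"
    using eq mod4_cases[of m] mod4_cases[of m']
    by (cases b; cases b') (auto simp: vertex_code_def split: if_splits)
  have "m = m' \<or> m div 4 = m' div 4 \<and> m mod 4 = m' mod 4"
    using eq mod4_cases[of m] mod4_cases[of m'] unfolding bb
    by (cases b') (auto simp: vertex_code_def split: if_splits)
  then show "v = v'" using eq_iff_div_mod_4[of m m'] v bb by blast
qed

lemma point_vertex_code: "point (vertex_code r v) \<in> cell (vertex_code r v)"
proof -
  obtain m b where v: "v = (m, b)" by (cases v)
  have "k < 4 \<Longrightarrow> point (k, InnerV, 0) \<in> cell (k, InnerV, 0)"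
    "k < 4 \<Longrightarrow> point (k, OuterV, 0) \<in> cell (k, OuterV, 0)" for k
    by (auto intro!: exI[of _ "1::real"] exI[of _ "3::real"] exI[of _ "0::real"] simp: complex_eq_iff)
  moreover have "k < 4 \<Longrightarrow> point (k, InsV, 1 / (real m + 2)) \<in> cell (k, InsV, 1 / (real m + 2))" for k
    by (auto intro!: exI[of _ "1 - 1 / (real m + 2)"] exI[of _ "3 * (1 / (real m + 2))"])
  ultimately show ?thesis
    unfolding v vertex_code_def by (cases b) (simp_all del: point.simps cell.simps)
qed

lemma cube_edge_kind: "fst (snd (cube_edge j j')) \<in> {InnerE, OuterE, Spoke}"
  by (simp add: cube_edge_def)

lemma edge_code_notin: "edge_code r m m' \<noteq> vertex_code r v"
proof -
  have "fst (snd (edge_code r m m')) \<in> {InnerE, OuterE, Spoke, InsInnerE, InsOuterE}"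
  proof (cases "m div 4 = r \<and> m' div 4 = r")
    case True
    then show ?thesis
      using cube_edge_kind[of "m mod 4" "m' mod 4"] by (auto simp: edge_code_def)
  qed (auto simp: edge_code_def)
  moreover have "fst (snd (cube_vertex b j)) \<in> {InnerV, OuterV}" for b j
    by (cases b) simp_all
  then have "fst (snd (vertex_code r v)) \<in> {InnerV, OuterV, InsV}"
    unfolding vertex_code_def by (auto split: prod.split)
  ultimately show ?thesis by auto
qed

lemma cube_edge_inj:
  assumes "j < 4" "j' < 4" "l < 4" "l' < 4" "j \<noteq> j'" "l \<noteq> l'" "cube_edge j j' = cube_edge l l'"
  shows "j = l \<and> j' = l'"
  using assms unfolding less_4_cases by (elim disjE) (simp_all add: cube_edge_def)

lemma layer_cases:
  assumes "layer m m' = r"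
  obtains "m div 4 = r" "m' div 4 = r"
  | "m div 4 = r" "m' div 4 \<noteq> r" "(m mod 4) div 2 = m' mod 2"
  | "m div 4 \<noteq> r" "m' div 4 = r" "(m mod 4) div 2 \<noteq> m' mod 2"
  using assms unfolding layer_def by (metis (full_types))

text \<open>Being an inner or an outer corner, together with the pair of corners selected by
  \<open>layer\<close>, determines the residue.\<close>

lemma eq_if_div_2:
  assumes "x < 4" "y < 4" "(x = 0 \<or> x = 3) = (y = 0 \<or> y = 3)" "x div 2 = y div (2::nat)"
  shows "x = y"
  using assms unfolding less_4_cases by (elim disjE) simp_all

lemma eq_if_mod_2:
  assumes "x < 4" "y < 4" "(x = 1 \<or> x = 2) = (y = 1 \<or> y = 2)" "x mod 2 = y mod (2::nat)"
  shows "x = y"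
  using assms unfolding less_4_cases by (elim disjE) simp_all

text \<open>The kind of the code tells whether one end is inserted, and the parity of the sector
  tells which one.\<close>

lemma edge_code_block:
  assumes "m div 4 = r \<or> m' div 4 = r"
  shows "(m div 4 \<noteq> r \<longleftrightarrow>
      fst (snd (edge_code r m m')) \<in> {InsInnerE, InsOuterE} \<and> even (fst (edge_code r m m'))) \<and>
    (m' div 4 \<noteq> r \<longleftrightarrow>
      fst (snd (edge_code r m m')) \<in> {InsInnerE, InsOuterE} \<and> odd (fst (edge_code r m m')))"
proof (cases "m div 4 = r")
  case m: True
  show ?thesis
  proof (cases "m' div 4 = r")
    case True
    then have "edge_code r m m' = cube_edge (m mod 4) (m' mod 4)"
      using m by (simp add: edge_code_def)
    then show ?thesis
      using cube_edge_kind[of "m mod 4" "m' mod 4"] m True by auto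
  qed (use m in \<open>simp add: edge_code_def\<close>)
next
  case False
  then show ?thesis using assms by (simp add: edge_code_def)
qed

text \<open>The parameter identifies the inserted end, the layer condition leaves two possible cube
  corners for the other end, and the kind decides between inner and outer.\<close>

lemma inj_edge_code:
  assumes "layer m m' = r" "layer l l' = r" "m \<noteq> m'" "l \<noteq> l'" and eq: "edge_code r m m' = edge_code r l l'"
  shows "m = l \<and> m' = l'"
proof -
  have "m div 4 = r \<or> m' div 4 = r" "l div 4 = r \<or> l' div 4 = r"
    using assms(1,2) unfolding layer_def by metis+
  then have same: "m div 4 = r \<longleftrightarrow> l div 4 = r" "m' div 4 = r \<longleftrightarrow> l' div 4 = r"
    using edge_code_block eq by metis+
  show ?thesis
  proof (rule layer_cases[OF assms(1)]; rule layer_cases[OF assms(2)])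
    assume "m div 4 = r" "m' div 4 = r" "l div 4 = r" "l' div 4 = r"
    then show ?thesis
      using eq assms(3,4) cube_edge_inj[of "m mod 4" "m' mod 4" "l mod 4" "l' mod 4"]
        eq_iff_div_mod_4[of m m'] eq_iff_div_mod_4[of l l'] eq_iff_div_mod_4[of m l] eq_iff_div_mod_4[of m' l']
      unfolding edge_code_def by (metis mod_less_divisor zero_less_numeral)
  next
    assume a: "m div 4 = r" "m' div 4 \<noteq> r" "(m mod 4) div 2 = m' mod 2"
      "l div 4 = r" "l' div 4 \<noteq> r" "(l mod 4) div 2 = l' mod 2"
    then have "m' = l'" using eq by (simp add: edge_code_def)
    moreover have "m mod 4 = l mod 4"
    proof -
      have "(m mod 4 = 0 \<or> m mod 4 = 3) = (l mod 4 = 0 \<or> l mod 4 = 3)"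
        using eq a(1,2,4,5) by (simp add: edge_code_def split: if_splits)
      moreover have "m mod 4 div 2 = l mod 4 div 2"
        using a(3,6) \<open>m' = l'\<close> by simp
      ultimately show ?thesis
        using eq_if_div_2[of "m mod 4" "l mod 4"] by simp
    qed
    ultimately show ?thesis using a eq_iff_div_mod_4[of m l] by simp
  next
    assume a: "m div 4 \<noteq> r" "m' div 4 = r" "(m mod 4) div 2 \<noteq> m' mod 2"
      "l div 4 \<noteq> r" "l' div 4 = r" "(l mod 4) div 2 \<noteq> l' mod 2"
    then have "m = l" using eq by (simp add: edge_code_def)
    moreover have "m' mod 4 = l' mod 4"
    proof -
      have "(m' mod 4 = 1 \<or> m' mod 4 = 2) = (l' mod 4 = 1 \<or> l' mod 4 = 2)"
        using eq a(1,4) \<open>m = l\<close> by (simp add: edge_code_def split: if_splits)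
      moreover
      \<comment> \<open>Two bits that differ from the same third bit are equal.\<close>
      have "m' mod 2 = l' mod 2"
      proof -
        have "(l mod 4) div 2 < 2" "m' mod 2 < 2" "l' mod 2 < 2" by auto
        moreover have "x = y" if "z < 2" "x < 2" "y < 2" "z \<noteq> x" "z \<noteq> y" for x y z :: nat
          using that by auto
        ultimately show ?thesis using a(3,6) \<open>m = l\<close> by metis
      qed
      then have "m' mod 4 mod 2 = l' mod 4 mod 2" by (simp add: mod_mod_cancel)
      ultimately show ?thesis
        using eq_if_mod_2[of "m' mod 4" "l' mod 4"] by simp
    qed
    ultimately show ?thesis using a eq_iff_div_mod_4[of m' l'] by simp
  \<comment> \<open>In the mixed cases the two edges leave the block at different ends,
    contradicting \<open>same\<close>.\<close>
  qed (insert same, blast+)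
qed

lemma cube_segment:
  assumes "j < 4" "j' < 4" "j \<noteq> j'"
  shows "open_segment (point (cube_vertex False j)) (point (cube_vertex True j')) \<subseteq> cell (cube_edge j j')"
  using assms unfolding less_4_cases
  by (elim disjE) (simp_all add: cube_edge_def segments segments_commute del: point.simps cell.simps)

lemma ins_segment:
  assumes "j < 4" "j' < 4" "0 < t" "t < 1"
  shows "j div 2 = j' mod 2 \<Longrightarrow> open_segment (point (cube_vertex False j)) (point (sector True j', InsV, t))
      \<subseteq> cell (sector True j', if j \<in> {0, 3} then InsInnerE else InsOuterE, t)"
    "j div 2 \<noteq> j' mod 2 \<Longrightarrow> open_segment (point (sector False j, InsV, t)) (point (cube_vertex True j'))
      \<subseteq> cell (sector False j, if j' \<in> {1, 2} then InsInnerE else InsOuterE, t)"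
proof -
  show "j div 2 = j' mod 2 \<Longrightarrow> open_segment (point (cube_vertex False j)) (point (sector True j', InsV, t))
      \<subseteq> cell (sector True j', if j \<in> {0, 3} then InsInnerE else InsOuterE, t)"
    using assms unfolding less_4_cases
    by (elim disjE) (simp_all add: segments segments_commute del: point.simps cell.simps)
  show "j div 2 \<noteq> j' mod 2 \<Longrightarrow> open_segment (point (sector False j, InsV, t)) (point (cube_vertex True j'))
      \<subseteq> cell (sector False j, if j' \<in> {1, 2} then InsInnerE else InsOuterE, t)"
    using assms unfolding less_4_cases
    by (elim disjE) (simp_all add: segments segments_commute del: point.simps cell.simps)
qed

lemma segment_edge_code:
  assumes "layer m m' = r" "m \<noteq> m'"
  shows "open_segment (point (vertex_code r (m, False))) (point (vertex_code r (m', True))) \<subseteq> cell (edge_code r m m')"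
proof -
  have t: "0 < 1 / (real n + 2)" "1 / (real n + 2) < 1" for n by auto
  have m: "m mod 4 < 4" "m' mod 4 < 4" by auto
  have mod2: "m' mod 2 = (m' mod 4) mod 2" by (simp add: mod_mod_cancel)
  note simps = edge_code_def vertex_code_def prod.case if_True if_False simp_thms
  show ?thesis
  proof (rule layer_cases[OF assms(1)])
    assume a: "m div 4 = r" "m' div 4 = r"
    then have "m mod 4 \<noteq> m' mod 4" using assms eq_iff_div_mod_4[of m m'] by auto
    then show ?thesis
      using cube_segment[OF m] by (simp only: simps a)
  next
    assume a: "m div 4 = r" "m' div 4 \<noteq> r" "(m mod 4) div 2 = m' mod 2"
    then show ?thesis
      using ins_segment(1)[OF m t] by (simp only: simps a mod2)
  next
    assume a: "m div 4 \<noteq> r" "m' div 4 = r" "(m mod 4) div 2 \<noteq> m' mod 2"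
    then show ?thesis
      using ins_segment(2)[OF m t] by (simp only: simps a mod2)
  qed
qed


section \<open>The thickness of the product with an edge\<close>

text \<open>Fixes the direction of every product edge; \<open>g\<close> and \<open>h\<close> run
  through both orders of an edge of \<open>E\<close>.\<close>

lemma kron_edges_K2: "kron_edges E K2_edges = {{(g, False), (h, True)} | g h. {g, h} \<in> E}"
proof (intro equalityI subsetI)
  fix e assume "e \<in> kron_edges E K2_edges"
  then obtain g g' h h' where e: "e = {(g, h), (g', h')}" "{g, g'} \<in> E" "{h, h'} = {False, True}"
    by (auto simp: kron_edges_def K2_edges_def)
  then consider "h = False" "h' = True" | "h = True" "h' = False"
    by (auto simp: doubleton_eq_iff)
  then show "e \<in> {{(g, False), (h, True)} | g h. {g, h} \<in> E}"
  proof cases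
    case 2
    then have "e = {(g', False), (g, True)}" "{g', g} \<in> E"
      using e by (simp_all add: insert_commute)
    then show ?thesis by blast
  qed (use e in blast)
qed (unfold kron_edges_def K2_edges_def, blast)

lemma simple_graph_edge:
  assumes "simple_graph V E" "{g, h} \<in> E"
  shows "g \<in> V" "h \<in> V" "g \<noteq> h"
proof -
  obtain u v where "{g, h} = {u, v}" "u \<noteq> v" "u \<in> V" "v \<in> V"
    using assms unfolding simple_graph_def by blast
  then show "g \<in> V" "h \<in> V" "g \<noteq> h" by (auto simp: doubleton_eq_iff)
qed

lemma planar_layer:
  assumes G: "simple_graph V E" and inj: "inj_on idx V"
  shows "planar (V \<times> UNIV) {{(g, False), (h, True)} | g h. {g, h} \<in> E \<and> layer (idx g) (idx h) = r}"
proof -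
  define A where "A = {((g, False), (h, True)) | g h. {g, h} \<in> E \<and> layer (idx g) (idx h) = r}"
  define vc where "vc v = vertex_code r (idx (fst v), snd v)" for v :: "'a \<times> bool"
  define ec where "ec u v = edge_code r (idx (fst u)) (idx (fst v))" for u v :: "'a \<times> bool"
  have AE: "\<exists>g h. u = (g, False) \<and> v = (h, True) \<and> g \<in> V \<and> h \<in> V \<and> idx g \<noteq> idx h \<and>
      layer (idx g) (idx h) = r" if "(u, v) \<in> A" for u v
    using that simple_graph_edge[OF G] inj_onD[OF inj] unfolding A_def by blast
  have "planar (V \<times> UNIV) {{u, v} | u v. (u, v) \<in> A}"
  proof (rule planar_straight_line[where cell = cell and vc = vc and ec = ec and pos = "\<lambda>v. point (vc v)"])
    show "c = d" if "z \<in> cell c" "z \<in> cell d" for c d z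
      using cell_unique that .
    show "point (vc v) \<in> cell (vc v)" for v
      unfolding vc_def by (rule point_vertex_code)
    show "inj_on vc (V \<times> UNIV)"
    proof (rule inj_onI)
      fix u v :: "'a \<times> bool" assume uv: "u \<in> V \<times> UNIV" "v \<in> V \<times> UNIV" "vc u = vc v"
      then have "(idx (fst u), snd u) = (idx (fst v), snd v)"
        unfolding vc_def by (intro injD[OF inj_vertex_code])
      then show "u = v"
        using uv inj_onD[OF inj, of "fst u" "fst v"] by (auto simp: prod_eq_iff)
    qed
  next
    fix u v assume uv: "(u, v) \<in> A"
    then obtain g h where gh: "u = (g, False)" "v = (h, True)" "g \<in> V" "h \<in> V" "idx g \<noteq> idx h"
      "layer (idx g) (idx h) = r"
      using AE by blast
    show "u \<in> V \<times> UNIV \<and> v \<in> V \<times> UNIV \<and> u \<noteq> v" using gh by simp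
    show "open_segment (point (vc u)) (point (vc v)) \<subseteq> cell (ec u v)"
      unfolding vc_def ec_def gh(1,2) fst_conv snd_conv by (rule segment_edge_code[OF gh(6,5)])
    show "ec u v \<notin> vc ` (V \<times> UNIV)"
      unfolding vc_def ec_def using edge_code_notin by blast
    fix u' v' assume uv': "(u', v') \<in> A" and eq: "ec u v = ec u' v'"
    then obtain g' h' where gh': "u' = (g', False)" "v' = (h', True)" "g' \<in> V" "h' \<in> V" "idx g' \<noteq> idx h'"
      "layer (idx g') (idx h') = r"
      using AE by blast
    have "idx g = idx g' \<and> idx h = idx h'"
      using inj_edge_code[OF gh(6) gh'(6) gh(5) gh'(5)] eq unfolding ec_def gh(1,2) gh'(1,2) fst_conv by blast
    then show "{u, v} = {u', v'}"
      using gh gh' inj_onD[OF inj] by metis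
  qed
  moreover have "{{u, v} | u v. (u, v) \<in> A} = {{(g, False), (h, True)} | g h. {g, h} \<in> E \<and> layer (idx g) (idx h) = r}"
    unfolding A_def by blast
  ultimately show ?thesis by simp
qed

section \<open>Covers by planar subgraphs and the two bounds\<close>

definition planar_cover :: "'a set \<Rightarrow> 'a set set \<Rightarrow> nat \<Rightarrow> bool" where
  "planar_cover V E k \<longleftrightarrow> (\<exists>(Vs :: nat \<Rightarrow> 'a set) (Es :: nat \<Rightarrow> 'a set set).
     (\<forall>i<k. Vs i \<subseteq> V \<and> Es i \<subseteq> E \<and> (\<forall>e\<in>Es i. e \<subseteq> Vs i) \<and> planar (Vs i) (Es i)) \<and>
     (\<Union>i<k. Vs i) = V \<and> (\<Union>i<k. Es i) = E)"

lemma thickness_eq_Least: "thickness V E = (LEAST k. planar_cover V E k)"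
  unfolding thickness_def planar_cover_def ..

lemma planar_cover_kron_K2:
  assumes G: "simple_graph V E" and n: "card V = n" "n > 0"
  shows "planar_cover (kron_verts V K2_verts) (kron_edges E K2_edges) ((n + 3) div 4)"
proof -
  define k where "k = (n + 3) div 4"
  have "finite V" using G by (simp add: simple_graph_def)
  then obtain idx where idx: "bij_betw idx V {0..<n}"
    using ex_bij_betw_finite_nat n by blast
  then have inj: "inj_on idx V" and less: "\<And>v. v \<in> V \<Longrightarrow> idx v < n"
    by (auto simp: bij_betw_def)
  \<comment> \<open>Every layer carries the full vertex set, so one layer suffices to cover the
    vertices, but one must exist.\<close>
  have "k > 0" using n by (simp add: k_def)
  have div: "idx v div 4 < k" if "v \<in> V" for v
    using less[OF that] unfolding k_def by linarith
  define Es where "Es r = {{(g, False), (h, True)} | g h. {g, h} \<in> E \<and> layer (idx g) (idx h) = r}" for r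
  have "layer (idx g) (idx h) < k" if "{g, h} \<in> E" for g h
    using div simple_graph_edge[OF G that] by (simp add: layer_def)
  then have un: "(\<Union>i<k. Es i) = kron_edges E K2_edges"
    unfolding kron_edges_K2 Es_def by blast
  have V: "kron_verts V K2_verts = V \<times> UNIV"
    by (simp add: kron_verts_def K2_verts_def)
  show ?thesis
    unfolding planar_cover_def k_def[symmetric]
  proof (intro exI[of _ "\<lambda>_. V \<times> UNIV"] exI[of _ Es] conjI allI impI ballI)
    fix i assume "i < k"
    then show "Es i \<subseteq> kron_edges E K2_edges" using un by blast
    show "planar (V \<times> UNIV) (Es i)"
      unfolding Es_def by (rule planar_layer[OF G inj])
    show "e \<subseteq> V \<times> UNIV" if "e \<in> Es i" for e
      using that simple_graph_edge[OF G] unfolding Es_def by blast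
  qed (use V \<open>k > 0\<close> un in auto)
qed

text \<open>Each edge of \<open>E\<close> has exactly two lifts, collected in \<open>D\<close>, and
  the lifts of different edges are disjoint.\<close>

lemma card_kron_edges_K2:
  assumes G: "simple_graph V E"
  shows "finite (kron_edges E K2_edges)" "card (kron_edges E K2_edges) = 2 * card E"
proof -
  define D where "D e = {{(g, False), (h, True)} | g h. {g, h} = e}" for e :: "'a set"
  have "finite V" using G by (simp add: simple_graph_def)
  then have finE: "finite E"
    by (rule finite_subset[rotated, OF finite_Pow_iff[THEN iffD2]])
      (use G in \<open>fastforce simp: simple_graph_def\<close>)
  have D: "card (D e) = 2 \<and> finite (D e)" if e: "e \<in> E" for e
  proof -
    obtain u v where uv: "e = {u, v}" "u \<noteq> v"
      using G e unfolding simple_graph_def by blast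
    then have "D e = {{(u, False), (v, True)}, {(v, False), (u, True)}}"
      unfolding D_def by (auto simp: doubleton_eq_iff)
    then show ?thesis using uv by (simp add: doubleton_eq_iff)
  qed
  have eq: "kron_edges E K2_edges = (\<Union>e\<in>E. D e)"
    unfolding kron_edges_K2 D_def by blast
  show "finite (kron_edges E K2_edges)"
    unfolding eq using finE D by blast
  have "D e \<inter> D e' = {}" if "e \<noteq> e'" for e e'
    using that unfolding D_def by (auto simp: doubleton_eq_iff)
  then have "card (\<Union>e\<in>E. D e) = (\<Sum>e\<in>E. card (D e))"
    using finE D by (intro card_UN_disjoint) auto
  then show "card (kron_edges E K2_edges) = 2 * card E"
    using D eq by simp
qed

text \<open>A bipartite planar subgraph on at most \<open>2 * n\<close> vertices has at most
  \<open>4 * n - 4\<close> edges, and \<open>k\<close> of them must cover \<open>2 * card E\<close>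
  edges. The bipartition is \<open>snd\<close>.\<close>

lemma planar_cover_kron_K2_lower:
  assumes G: "simple_graph V E" and n: "card V = n" "n \<ge> 2"
    and cover: "planar_cover (kron_verts V K2_verts) (kron_edges E K2_edges) k"
  shows "card E \<le> k * (2 * n - 2)"
proof -
  obtain Vs Es where "\<forall>i<k. Vs i \<subseteq> kron_verts V K2_verts \<and> Es i \<subseteq> kron_edges E K2_edges \<and>
      (\<forall>e\<in>Es i. e \<subseteq> Vs i) \<and> planar (Vs i) (Es i)" and un: "(\<Union>i<k. Es i) = kron_edges E K2_edges"
    using cover unfolding planar_cover_def by (elim exE conjE)
  then have cov: "Vs i \<subseteq> kron_verts V K2_verts \<and> Es i \<subseteq> kron_edges E K2_edges \<and>
      (\<forall>e\<in>Es i. e \<subseteq> Vs i) \<and> planar (Vs i) (Es i)" if "i < k" for i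
    using that by simp
  have finV: "finite V" using G by (simp add: simple_graph_def)
  have fin: "finite (kron_verts V K2_verts)" "card (kron_verts V K2_verts) = 2 * n"
    using finV n by (auto simp: kron_verts_def K2_verts_def card_cartesian_product)
  have "card (Es i) \<le> 4 * n - 4" if i: "i < k" for i
  proof -
    have Ei: "\<exists>g h. e = {(g, False), (h, True)}" if "e \<in> Es i" for e
      using cov[OF i] that unfolding kron_edges_K2 by blast
    have "simple_graph (Vs i) (Es i)"
      unfolding simple_graph_def
    proof (intro conjI ballI)
      show "finite (Vs i)" using cov[OF i] fin finite_subset by blast
      fix e assume e: "e \<in> Es i"
      then obtain g h where gh: "e = {(g, False), (h, True)}" using Ei by blast
      moreover have "e \<subseteq> Vs i" using cov[OF i] e by simp
      ultimately show "\<exists>u v. e = {u, v} \<and> u \<noteq> v \<and> u \<in> Vs i \<and> v \<in> Vs i"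
        by (intro exI[of _ "(g, False)"] exI[of _ "(h, True)"]) simp
    qed
    moreover have "snd u \<noteq> snd v" if "{u, v} \<in> Es i" for u v
      using Ei[OF that] by (auto simp: doubleton_eq_iff)
    moreover have "card (Vs i) \<le> 2 * n"
      using cov[OF i] fin card_mono by metis
    ultimately have "card (Es i) + 4 \<le> 2 * (2 * n)"
      using cov[OF i] n by (intro planar_bipartite_card_edges_le[of "Vs i" _ snd]) auto
    then show ?thesis by simp
  qed
  then have "(\<Sum>i<k. card (Es i)) \<le> (\<Sum>i<k. 4 * n - 4)"
    by (intro sum_mono) auto
  moreover have "card (kron_edges E K2_edges) \<le> (\<Sum>i<k. card (Es i))"
    unfolding un[symmetric] by (rule card_UN_le) simp
  ultimately have "2 * card E \<le> k * (4 * n - 4)"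
    using card_kron_edges_K2[OF G] by simp
  also have "\<dots> = 2 * (k * (2 * n - 2))"
    by (simp add: diff_mult_distrib2)
  finally show ?thesis by simp
qed

theorem theorem3p4:
  fixes V :: "'a set" and E :: "'a set set" and n :: nat
  assumes "simple_graph V E" and "card V = n" and "n \<ge> 2"
  shows "\<lceil>real (card E) / (2 * real n - 2)\<rceil>
           \<le> int (thickness (kron_verts V K2_verts) (kron_edges E K2_edges)) \<and>
         int (thickness (kron_verts V K2_verts) (kron_edges E K2_edges)) \<le> \<lceil>real n / 4\<rceil>"
proof
  let ?V = "kron_verts V K2_verts" and ?E = "kron_edges E K2_edges"
  define k where "k = thickness ?V ?E"
  have cover: "planar_cover ?V ?E ((n + 3) div 4)"
    using planar_cover_kron_K2[OF assms(1,2)] assms(3) by simp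
  \<comment> \<open>The cover built for the upper bound shows that the minimum in
    \<open>thickness\<close> is attained.\<close>
  then have "planar_cover ?V ?E k"
    unfolding k_def thickness_eq_Least by (rule LeastI)
  then have "card E \<le> k * (2 * n - 2)"
    using planar_cover_kron_K2_lower assms by blast
  then have "real (card E) \<le> real (k * (2 * n - 2))"
    by (simp only: of_nat_le_iff)
  also have "\<dots> = real k * (2 * real n - 2)"
    using assms(3) by (simp add: of_nat_diff)
  finally have "real (card E) / (2 * real n - 2) \<le> real k"
    using assms(3) by (simp add: pos_divide_le_eq)
  then show "\<lceil>real (card E) / (2 * real n - 2)\<rceil> \<le> int (thickness ?V ?E)"
    unfolding k_def[symmetric] by (simp add: ceiling_le_iff)
  have "thickness ?V ?E \<le> (n + 3) div 4"
    unfolding thickness_eq_Least using cover by (rule Least_le)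
  moreover have "int ((n + 3) div 4) \<le> \<lceil>real n / 4\<rceil>"
  proof -
    have "real n / 4 \<le> of_int \<lceil>real n / 4\<rceil>" by (rule le_of_int_ceiling)
    then have "real_of_int (int n) \<le> real_of_int (4 * \<lceil>real n / 4\<rceil>)" by linarith
    then have "int n \<le> 4 * \<lceil>real n / 4\<rceil>" by (simp only: of_int_le_iff)
    then show ?thesis by linarith
  qed
  ultimately show "int (thickness ?V ?E) \<le> \<lceil>real n / 4\<rceil>" by linarith
qed

end
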